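(* Consider a $K$-armed Gaussian bandit in which the rewards of arm $k\in[K]$ are i.i.d. $N(\mu_k,1)$, with arm $1$ optimal ($\mu_1=\max_{k}\mu_k$) and $\Delta_k=\mu_1-\mu_k$. Run the \texttt{ReBoot} algorithm with Gaussian bootstrap weights and exploration aid unit $\sigma_a>1.5$. Then for every horizon $T\ge 2$ the regret satisfies $$R(T)\le \sum_{k=2}^{K}\Delta_k\Big[6+\big\{C_1(\sigma_a)+C_2(\sigma_a)\Delta_k^{-2}\big\}\log T\Big],$$ where $$C_1(\sigma_a)=8(2\sigma_a^2-1)^{-1},\qquad C_2(\sigma_a)=128\sigma_a^2\Big(3.1+2\big(1-2.25\,\sigma_a^{-2}\big)^{-1/2}\Big).$$
   Context: \texttt{ReBoot} algorithm with Gaussian weights and exploration aid unit $\sigma_a>0$: in rounds $t=1,\dots,K$ arm $t$ is pulled once. In each round $t>K$, for each arm $k$, let $Y_{k,1},\dots,Y_{k,s}$ be the $s\ge1$ rewards observed so far from arm $k$, $\bar Y_{k,s}=s^{-1}\sum_{i=1}^s Y_{k,i}$, residuals $e_{k,i}=Y_{k,i}-\bar Y_{k,s}$ for $i\le s$, and pseudo residuals $e_{k,s+1}=\sqrt{s+2}\,\sigma_a$, $e_{k,s+2}=-\sqrt{s+2}\,\sigma_a$. Draw fresh weights $w_1,\dots,w_{s+2}$ i.i.d. $N(0,1)$, independent of everything else, and set the index $\hat\mu^*_{k}=\bar Y_{k,s}+\frac{1}{s+2}\sum_{i=1}^{s+2}w_ie_{k,i}$. Pull $I_t=\arg\max_k\hat\mu^*_k$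 and observe its reward. The regret is $R(T)=T\mu_1-E[\sum_{t=1}^T r_t]=\sum_{k=2}^K\Delta_k E[\sum_{t=1}^T \mathbf 1\{I_t=k\}]$, where $r_t$ is the reward at round $t$. *)

theory Defs
  imports "HOL-Probability.Probability"
begin

text \<open>Deterministic description of ReBoot given the realised reward stacks and weights.
  X k j : reward of the (j+1)-th pull of arm k.
  W n k i : the i-th Gaussian weight drawn for arm k in round n+1 (0-based round n).
  A history is the list of arms pulled so far (arms are 1..K).\<close>

definition pulls :: "nat list \<Rightarrow> nat \<Rightarrow> nat" where
  "pulls h k = length (filter (\<lambda>j. j = k) h)"

definition reboot_idx ::
  "real \<Rightarrow> (nat \<Rightarrow> nat \<Rightarrow> real) \<Rightarrow> (nat \<Rightarrow> nat \<Rightarrow> nat \<Rightarrow> real) \<Rightarrow> nat list \<Rightarrow> nat \<Rightarrow> nat \<Rightarrow> real" where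
  "reboot_idx \<sigma>a X W h n k =
     (let s = pulls h k;
          ybar = (\<Sum>i<s. X k i) / real s;
          e = (\<lambda>i. if i < s then X k i - ybar
                   else if i = s then sqrt (real s + 2) * \<sigma>a
                   else - (sqrt (real s + 2) * \<sigma>a))
      in ybar + (\<Sum>i<s + 2. W n k i * e i) / (real s + 2))"

text \<open>Argmax over arms 1..K; ties (a null event) broken by smallest index.\<close>
definition argmax_arm :: "nat \<Rightarrow> (nat \<Rightarrow> real) \<Rightarrow> nat" where
  "argmax_arm K f = (LEAST k. k \<in> {1..K} \<and> (\<forall>j\<in>{1..K}. f j \<le> f k))"

fun reboot_hist ::
  "nat \<Rightarrow> real \<Rightarrow> (nat \<Rightarrow> nat \<Rightarrow> real) \<Rightarrow> (nat \<Rightarrow> nat \<Rightarrow> nat \<Rightarrow> real) \<Rightarrow> nat \<Rightarrow> nat list" where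
  "reboot_hist K \<sigma>a X W 0 = []"
| "reboot_hist K \<sigma>a X W (Suc n) =
     (let h = reboot_hist K \<sigma>a X W n
      in h @ [if n < K then n + 1 else argmax_arm K (reboot_idx \<sigma>a X W h n)])"

definition reboot_C1 :: "real \<Rightarrow> real" where
  "reboot_C1 \<sigma>a = 8 / (2 * \<sigma>a\<^sup>2 - 1)"

definition reboot_C2 :: "real \<Rightarrow> real" where
  "reboot_C2 \<sigma>a = 128 * \<sigma>a\<^sup>2 * (3.1 + 2 / sqrt (1 - 2.25 / \<sigma>a\<^sup>2))"

end

theory Submission
  imports Defs
begin

text \<open>
  Fix a suboptimal arm \<open>k\<close> with gap \<open>D\<close> and the threshold \<open>\<tau> = \<mu>\<^sub>1 - D/2\<close>. Given the past, the index of
  an arm with \<open>s\<close> pulls is Gaussian around the sample mean, with variance at least \<open>2\<sigma>\<^sup>2/(s+2)\<close> thanks to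
  the pseudo residuals, and at most \<open>4\<sigma>\<^sup>2/(s+2)\<close> unless the residual sum of squares is atypically large.

  Pulls of \<open>k\<close> with index above \<open>\<tau>\<close>: once \<open>s \<ge> 128 \<sigma>\<^sup>2 ln T / D\<^sup>2\<close> and the rewards of \<open>k\<close> are concentrated,
  such a pull has probability at most \<open>1/T\<close> in each round.

  Pulls of \<open>k\<close> with index below \<open>\<tau>\<close>: as for Thompson sampling, if \<open>Q\<^sub>s\<close> is the probability that the index of
  arm 1 exceeds \<open>\<tau>\<close> after \<open>s\<close> pulls, their expected number is at most the sum over \<open>s\<close> of \<open>E[1/Q\<^sub>s - 1]\<close>.
  Each term decays exponentially in \<open>s D\<^sup>2/\<sigma>\<^sup>2\<close>. When the sample mean of arm 1 is below \<open>\<tau>\<close>, \<open>1/Q\<^sub>s\<close> is bounded by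
  a multiple of \<open>exp (9 Z\<^sup>2 / (8 \<sigma>\<^sup>2))\<close> for a standard normal \<open>Z\<close>; its expectation is finite exactly for
  \<open>\<sigma> > 3/2\<close> and produces the factor \<open>(1 - 2.25/\<sigma>\<^sup>2)\<^sup>-\<^sup>1\<^sup>/\<^sup>2\<close>.
\<close>

section \<open>Gaussian tails and exponential moments\<close>

definition gauss_tail :: "real \<Rightarrow> real" where
  "gauss_tail x = measure (density lborel std_normal_density) {x..}"

text \<open>With the half line shifted to start at 0, the two tail bounds below become pointwise
  comparisons of integrands in which only the cross term \<open>x * u\<close> of
  \<open>(x + u)\<^sup>2 / 2\<close> has to be estimated.\<close>

lemma gauss_tail_eq_nn_integral:
  "ennreal (gauss_tail x) = (\<integral>\<^sup>+u. ennreal (std_normal_density (x + u)) * indicator {0..} u \<partial>lborel)"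
proof -
  interpret prob_space "density lborel std_normal_density"
    by (rule prob_space_normal_density) simp
  have "ennreal (gauss_tail x) = emeasure (density lborel std_normal_density) {x..}"
    by (simp add: gauss_tail_def emeasure_eq_measure)
  also have "\<dots> = (\<integral>\<^sup>+z. ennreal (std_normal_density z) * indicator {x..} z \<partial>lborel)"
    by (subst emeasure_density) auto
  also have "\<dots> = (\<integral>\<^sup>+u. ennreal (std_normal_density (x + 1 * u)) * indicator {x..} (x + 1 * u) \<partial>lborel)"
    by (subst nn_integral_real_affine[where c=1 and t=x]) auto
  finally show ?thesis
    by (simp add: indicator_def)
qed

lemma nn_integral_gauss_half_line:
  assumes "0 < a"
  shows "(\<integral>\<^sup>+u. ennreal (exp (- (a * u\<^sup>2))) * indicator {0..} u \<partial>lborel) = ennreal (sqrt (pi / a) / 2)"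
proof -
  have "(\<integral>\<^sup>+u. ennreal (exp (- u\<^sup>2)) * indicator {0..} u \<partial>lborel) =
      (\<integral>\<^sup>+u. ennreal (indicator {0..} u *\<^sub>R exp (- u\<^sup>2)) \<partial>lborel)"
    by (intro nn_integral_cong) (auto simp: indicator_def)
  also have "\<dots> = ennreal (sqrt pi / 2)"
    using gaussian_moment_0 by (intro nn_integral_eq_integral[THEN trans])
      (auto simp: has_bochner_integral_iff)
  finally have base: "(\<integral>\<^sup>+u. ennreal (exp (- u\<^sup>2)) * indicator {0..} u \<partial>lborel) = ennreal (sqrt pi / 2)" .
  have "ennreal (sqrt pi / 2) = ennreal \<bar>sqrt a\<bar> *
      (\<integral>\<^sup>+u. ennreal (exp (- (0 + sqrt a * u)\<^sup>2)) * indicator {0..} (0 + sqrt a * u) \<partial>lborel)"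
    unfolding base[symmetric] using assms
    by (intro nn_integral_real_affine) auto
  also have "(\<integral>\<^sup>+u. ennreal (exp (- (0 + sqrt a * u)\<^sup>2)) * indicator {0..} (0 + sqrt a * u) \<partial>lborel) =
      (\<integral>\<^sup>+u. ennreal (exp (- (a * u\<^sup>2))) * indicator {0..} u \<partial>lborel)"
    using assms by (intro nn_integral_cong) (auto simp: indicator_def power_mult_distrib zero_le_mult_iff)
  finally have eq: "ennreal (sqrt a) * (\<integral>\<^sup>+u. ennreal (exp (- (a * u\<^sup>2))) * indicator {0..} u \<partial>lborel) = ennreal (sqrt pi / 2)"
    using assms by simp
  have "(\<integral>\<^sup>+u. ennreal (exp (- (a * u\<^sup>2))) * indicator {0..} u \<partial>lborel) =
      ennreal (1 / sqrt a) * (ennreal (sqrt a) * (\<integral>\<^sup>+u. ennreal (exp (- (a * u\<^sup>2))) * indicator {0..} u \<partial>lborel))"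
    using assms by (simp add: mult.assoc[symmetric] ennreal_mult[symmetric])
  also have "\<dots> = ennreal (sqrt (pi / a) / 2)"
    unfolding eq using assms by (simp add: ennreal_mult[symmetric] real_sqrt_divide)
  finally show ?thesis .
qed

text \<open>The cross term is nonnegative here and is dropped. The factor 1/2 is the mass of half a
  Gaussian; keeping it lets two one-sided tails add up to a plain exponential and yields
  \<open>gauss_tail x \<ge> 1/2\<close> for nonpositive \<open>x\<close>.\<close>

lemma gauss_tail_le_exp:
  assumes "0 \<le> x"
  shows "gauss_tail x \<le> exp (- x\<^sup>2 / 2) / 2"
proof -
  have "ennreal (gauss_tail x) \<le> (\<integral>\<^sup>+u. ennreal (exp (- x\<^sup>2 / 2) / sqrt (2 * pi)) *
      (ennreal (exp (- (1/2 * u\<^sup>2))) * indicator {0..} u) \<partial>lborel)"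
    unfolding gauss_tail_eq_nn_integral
  proof (intro nn_integral_mono)
    fix u :: real
    have "exp (- (x + u)\<^sup>2 / 2) \<le> exp (- x\<^sup>2 / 2) * exp (- (1/2 * u\<^sup>2))" if "0 \<le> u"
      using mult_nonneg_nonneg[OF assms that]
      by (simp add: exp_add[symmetric] power2_eq_square field_simps)
    then show "ennreal (std_normal_density (x + u)) * indicator {0..} u \<le>
        ennreal (exp (- x\<^sup>2 / 2) / sqrt (2 * pi)) * (ennreal (exp (- (1/2 * u\<^sup>2))) * indicator {0..} u)"
      by (auto simp: indicator_def std_normal_density_def ennreal_mult[symmetric] divide_right_mono)
  qed
  also have "\<dots> = ennreal (exp (- x\<^sup>2 / 2) / sqrt (2 * pi)) * ennreal (sqrt (pi / (1/2)) / 2)"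
    by (subst nn_integral_cmult, simp, subst nn_integral_gauss_half_line) auto
  also have "\<dots> = ennreal (exp (- x\<^sup>2 / 2) / 2)"
    by (simp add: ennreal_mult[symmetric] real_sqrt_mult)
  finally show ?thesis
    by simp
qed

text \<open>From \<open>x u \<le> x\<^sup>2/4 + u\<^sup>2\<close>. The Gaussian factor \<open>exp (- x\<^sup>2/4)\<close> is sacrificed to avoid the
  polynomial correction of the sharp tail.\<close>

lemma gauss_tail_ge_exp:
  "exp (- (3/4 * x\<^sup>2)) / (2 * sqrt 3) \<le> gauss_tail x"
proof -
  \<comment> \<open>The constant is \<open>1 / sqrt (2 * pi)\<close> times the half line integral of
    \<open>exp (- (3/2 * u\<^sup>2))\<close>.\<close>
  have "ennreal (exp (- (3/4 * x\<^sup>2)) / (2 * sqrt 3)) =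
      ennreal (exp (- (3/4 * x\<^sup>2)) / sqrt (2 * pi)) * ennreal (sqrt (pi / (3/2)) / 2)"
    by (simp add: ennreal_mult[symmetric] real_sqrt_mult real_sqrt_divide)
  also have "\<dots> = (\<integral>\<^sup>+u. ennreal (exp (- (3/4 * x\<^sup>2)) / sqrt (2 * pi)) *
      (ennreal (exp (- (3/2 * u\<^sup>2))) * indicator {0..} u) \<partial>lborel)"
    by (subst nn_integral_cmult, simp, subst nn_integral_gauss_half_line) auto
  also have "\<dots> \<le> ennreal (gauss_tail x)"
    unfolding gauss_tail_eq_nn_integral
  proof (intro nn_integral_mono)
    fix u :: real
    have "exp (- (3/4 * x\<^sup>2)) * exp (- (3/2 * u\<^sup>2)) \<le> exp (- (x + u)\<^sup>2 / 2)"
      using sum_squares_ge_zero[of "x / 2 - u" 0] unfolding exp_add[symmetric]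
      by (simp add: power2_eq_square algebra_simps)
    then show "ennreal (exp (- (3/4 * x\<^sup>2)) / sqrt (2 * pi)) *
        (ennreal (exp (- (3/2 * u\<^sup>2))) * indicator {0..} u) \<le>
        ennreal (std_normal_density (x + u)) * indicator {0..} u"
      by (auto simp: indicator_def std_normal_density_def ennreal_mult[symmetric] divide_right_mono)
  qed
  finally show ?thesis
    by (simp add: gauss_tail_def)
qed

lemma gauss_tail_pos: "0 < gauss_tail x"
  using gauss_tail_ge_exp[of x] by (rule less_le_trans[rotated]) simp

lemma gauss_tail_le_1: "gauss_tail x \<le> 1"
  unfolding gauss_tail_def by (intro prob_space.prob_le_1 prob_space_normal_density) simp

lemma borel_measurable_gauss_tail [measurable]: "gauss_tail \<in> borel_measurable borel"
proof -
  interpret prob_space "density lborel std_normal_density"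
    by (rule prob_space_normal_density) simp
  have "mono (\<lambda>x. - gauss_tail x)"
    by (auto simp: mono_def gauss_tail_def intro!: finite_measure_mono)
  then have "(\<lambda>x. - (- gauss_tail x)) \<in> borel_measurable borel"
    by (intro borel_measurable_uminus borel_measurable_mono)
  then show ?thesis by simp
qed

context prob_space
begin

lemma emeasure_std_normal_ge:
  assumes "distributed M lborel Z std_normal_density"
  shows "emeasure M {\<omega> \<in> space M. x \<le> Z \<omega>} = ennreal (gauss_tail x)"
proof -
  have "emeasure M {\<omega> \<in> space M. x \<le> Z \<omega>} = emeasure M (Z -` {x..} \<inter> space M)"
    by (intro arg_cong2[where f=emeasure]) auto
  also have "\<dots> = emeasure (density lborel std_normal_density) {x..}"
    using distributed_emeasure[OF assms, of "{x..}"] by (simp add: emeasure_density)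
  also have "\<dots> = ennreal (gauss_tail x)"
    unfolding gauss_tail_def
    by (intro finite_measure.emeasure_eq_measure prob_space.finite_measure prob_space_normal_density) simp
  finally show ?thesis .
qed

lemma distributed_std_normal_uminus:
  assumes "distributed M lborel Z std_normal_density"
  shows "distributed M lborel (\<lambda>\<omega>. - Z \<omega>) std_normal_density"
  using normal_density_affine[OF assms, of "-1" 0] by simp

text \<open>Tilting by \<open>exp (a * z\<^sup>2)\<close> turns the standard normal density into a
  multiple of the centred normal density with variance \<open>1 / (1 - 2 * a)\<close>. It serves
  with \<open>a = 1/4\<close> for sums of squared rewards and with
  \<open>a = 9 / (8 * \<sigma>\<^sup>2)\<close> for the odds of arm 1.\<close>

lemma nn_integral_exp_square_normal:
  assumes Z: "distributed M lborel Z std_normal_density" and a: "a < 1/2"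
  shows "(\<integral>\<^sup>+\<omega>. ennreal (exp (a * (Z \<omega>)\<^sup>2)) \<partial>M) = ennreal (1 / sqrt (1 - 2 * a))"
proof -
  define r where "r = 1 / sqrt (1 - 2 * a)"
  have r: "0 < r" using a by (simp add: r_def)
  have r2: "r\<^sup>2 = 1 / (1 - 2 * a)" using a by (simp add: r_def power_divide)
  have eq: "std_normal_density z * exp (a * z\<^sup>2) = r * normal_density 0 r z" for z
  proof -
    have "exp (- z\<^sup>2 / 2) * exp (a * z\<^sup>2) = exp (- z\<^sup>2 / (2 * r\<^sup>2))"
      unfolding exp_add[symmetric] r2 using a by (simp add: field_simps)
    moreover have "sqrt (2 * pi * r\<^sup>2) = r * sqrt (2 * pi)"
      using r by (simp add: real_sqrt_mult)
    ultimately show ?thesis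
      using r by (simp add: normal_density_def)
  qed
  have "(\<integral>\<^sup>+\<omega>. ennreal (exp (a * (Z \<omega>)\<^sup>2)) \<partial>M) =
      (\<integral>\<^sup>+z. ennreal (std_normal_density z) * ennreal (exp (a * z\<^sup>2)) \<partial>lborel)"
    by (subst distributed_nn_integral[OF Z]) auto
  also have "\<dots> = (\<integral>\<^sup>+z. ennreal r * ennreal (normal_density 0 r z) \<partial>lborel)"
    using r by (intro nn_integral_cong) (simp add: ennreal_mult[symmetric] eq)
  also have "\<dots> = ennreal r"
    using r by (subst nn_integral_cmult) (auto simp: nn_integral_eq_integral)
  finally show ?thesis by (simp add: r_def)
qed

end

text \<open>The closed half lines above and below \<open>x\<close> cover the real line, and
  reflection gives the lower one the mass \<open>gauss_tail (- x)\<close>.\<close>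

lemma gauss_tail_uminus_ge: "1 - gauss_tail x \<le> gauss_tail (- x)"
proof -
  let ?N = "density lborel std_normal_density"
  interpret prob_space ?N
    by (rule prob_space_normal_density) simp
  have Z: "distributed ?N lborel (\<lambda>z. z) std_normal_density"
    by (simp add: distributed_def distr_id2)
  have "1 \<le> emeasure ?N {z \<in> space ?N. x \<le> z} + emeasure ?N {z \<in> space ?N. - x \<le> - z}"
    unfolding emeasure_space_1[symmetric]
    by (rule order_trans[OF emeasure_mono emeasure_subadditive]) auto
  then have "1 \<le> ennreal (gauss_tail x) + ennreal (gauss_tail (- x))"
    by (simp only: emeasure_std_normal_ge[OF Z] emeasure_std_normal_ge[OF distributed_std_normal_uminus[OF Z]])
  then have "ennreal 1 \<le> ennreal (gauss_tail x + gauss_tail (- x))"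
    by (simp add: less_imp_le[OF gauss_tail_pos])
  then show ?thesis
    by (subst (asm) ennreal_le_iff) (auto intro: add_nonneg_nonneg less_imp_le[OF gauss_tail_pos])
qed

text \<open>\<open>1 / Q - 1\<close> is the ratio of failure to success probability, the form in
  which the comparison of arms uses \<open>Q\<close>. The bound is the reciprocal of the lower tail
  bound.\<close>

lemma gauss_tail_odds_nonneg:
  assumes "0 \<le> x"
  shows "1 / gauss_tail x - 1 \<le> 2 * sqrt 3 * exp (3/4 * x\<^sup>2)"
proof -
  have "1 / gauss_tail x \<le> 1 / (exp (- (3/4 * x\<^sup>2)) / (2 * sqrt 3))"
    by (intro divide_left_mono gauss_tail_ge_exp mult_pos_pos gauss_tail_pos) auto
  also have "\<dots> = 2 * sqrt 3 * exp (3/4 * x\<^sup>2)"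
    by (simp add: exp_minus field_simps)
  finally show ?thesis by simp
qed

text \<open>The failure probability is at most \<open>exp (- x\<^sup>2 / 2) / 2\<close>, so success
  has probability at least 1/2; dividing by it at most doubles the bound and cancels the factor
  1/2.\<close>

lemma gauss_tail_odds_nonpos:
  assumes "x \<le> 0"
  shows "1 / gauss_tail x - 1 \<le> exp (- x\<^sup>2 / 2)"
proof -
  have b: "1 - gauss_tail x \<le> exp (- x\<^sup>2 / 2) / 2"
    using gauss_tail_uminus_ge[of x] gauss_tail_le_exp[of "- x"] assms by simp
  have "exp (- x\<^sup>2 / 2) \<le> 1" by simp
  then have h: "1/2 \<le> gauss_tail x" using b by linarith
  have "1 / gauss_tail x - 1 = (1 - gauss_tail x) / gauss_tail x"
    using gauss_tail_pos[of x] by (simp add: field_simps)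
  also have "\<dots> \<le> (1 - gauss_tail x) / (1/2)"
    using h gauss_tail_le_1[of x] by (intro divide_left_mono) auto
  also have "\<dots> \<le> exp (- x\<^sup>2 / 2)" using b by simp
  finally show ?thesis .
qed

section \<open>The bootstrap score of one arm\<close>

definition sample_mean :: "nat \<Rightarrow> (nat \<Rightarrow> real) \<Rightarrow> real" where
  "sample_mean s y = (\<Sum>i<s. y i) / real s"

definition residual :: "real \<Rightarrow> nat \<Rightarrow> (nat \<Rightarrow> real) \<Rightarrow> nat \<Rightarrow> real" where
  "residual \<sigma> s y i =
    (if i < s then y i - sample_mean s y
     else if i = s then sqrt (real s + 2) * \<sigma> else - (sqrt (real s + 2) * \<sigma>))"

definition score :: "real \<Rightarrow> nat \<Rightarrow> (nat \<Rightarrow> real) \<Rightarrow> (nat \<Rightarrow> real) \<Rightarrow> real" where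
  "score \<sigma> s y w = sample_mean s y + (\<Sum>i<s + 2. w i * residual \<sigma> s y i) / (real s + 2)"

text \<open>The conditional standard deviation of \<open>score\<close> given the rewards, for
  independent standard normal weights.\<close>

definition score_sd :: "real \<Rightarrow> nat \<Rightarrow> (nat \<Rightarrow> real) \<Rightarrow> real" where
  "score_sd \<sigma> s y = sqrt (\<Sum>i<s + 2. (residual \<sigma> s y i)\<^sup>2) / (real s + 2)"

text \<open>The conditional probability, given the rewards, that the index reaches
  \<open>\<tau>\<close>; \<open>emeasure_score_ge\<close> justifies this reading.\<close>

definition score_tail :: "real \<Rightarrow> real \<Rightarrow> nat \<Rightarrow> (nat \<Rightarrow> real) \<Rightarrow> real" where
  "score_tail \<sigma> \<tau> s y = gauss_tail ((\<tau> - sample_mean s y) / score_sd \<sigma> s y)"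

section \<open>Conditional variance of the bootstrap index\<close>

lemma reboot_idx_eq_score: "reboot_idx \<sigma> X W h n k = score \<sigma> (pulls h k) (X k) (W n k)"
  unfolding reboot_idx_def score_def residual_def sample_mean_def Let_def by simp

text \<open>The two pseudo residuals add exactly \<open>2 * (s + 2) * \<sigma>\<^sup>2\<close> to
  the sum of squares. This separates a guaranteed variance from the part that depends on the
  rewards.\<close>

lemma score_sd_sq:
  "(score_sd \<sigma> s y)\<^sup>2 = ((\<Sum>i<s. (y i - sample_mean s y)\<^sup>2) / (real s + 2) + 2 * \<sigma>\<^sup>2) / (real s + 2)"
proof -
  have "(\<Sum>i<s + 2. (residual \<sigma> s y i)\<^sup>2) = (\<Sum>i<s. (y i - sample_mean s y)\<^sup>2) + 2 * (real s + 2) * \<sigma>\<^sup>2"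
    by (simp add: residual_def power_mult_distrib)
  moreover have "0 \<le> (\<Sum>i<s + 2. (residual \<sigma> s y i)\<^sup>2)"
    by (intro sum_nonneg) auto
  ultimately show ?thesis
    unfolding score_sd_def power_divide by (simp add: field_simps power2_eq_square)
qed

lemma score_sd_sq_ge: "2 * \<sigma>\<^sup>2 / (real s + 2) \<le> (score_sd \<sigma> s y)\<^sup>2"
  unfolding score_sd_sq by (intro divide_right_mono) (auto intro!: divide_nonneg_nonneg sum_nonneg)

lemma score_sd_pos:
  assumes "0 < \<sigma>"
  shows "0 < score_sd \<sigma> s y"
proof -
  have "0 < 2 * \<sigma>\<^sup>2 / (real s + 2)" using assms by simp
  then have "(score_sd \<sigma> s y)\<^sup>2 \<noteq> 0" using score_sd_sq_ge[of \<sigma> s y] by linarith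
  moreover have "0 \<le> score_sd \<sigma> s y"
    by (simp add: score_sd_def sum_nonneg)
  ultimately show ?thesis by (simp add: less_le)
qed

text \<open>The sample mean minimises the sum of squares, because the cross term vanishes. Centring
  at the true mean instead leaves a sum of independent terms, which is easier to control.\<close>

lemma sum_sq_sample_mean_le: "(\<Sum>i<s. (y i - sample_mean s y)\<^sup>2) \<le> (\<Sum>i<s. (y i - c)\<^sup>2)"
proof (cases "s = 0")
  case False
  let ?m = "sample_mean s y"
  have "(\<Sum>i<s. (y i - c)\<^sup>2) = (\<Sum>i<s. (y i - ?m)\<^sup>2 + (2 * (?m - c) * (y i - ?m) + (?m - c)\<^sup>2))"
    by (intro sum.cong) (auto simp: power2_eq_square algebra_simps)
  also have "\<dots> = (\<Sum>i<s. (y i - ?m)\<^sup>2) + 2 * (?m - c) * (\<Sum>i<s. y i - ?m) + real s * (?m - c)\<^sup>2"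
    by (simp add: sum.distrib sum_distrib_left)
  also have "(\<Sum>i<s. y i - ?m) = 0"
    using False by (simp add: sum_subtractf sample_mean_def)
  finally show ?thesis by simp
qed simp

text \<open>The threshold on the sum of squares is the level at which the true residuals add no more
  variance than the pseudo residuals.\<close>

lemma score_sd_sq_le:
  assumes "(\<Sum>i<s. (y i - c)\<^sup>2) \<le> 2 * \<sigma>\<^sup>2 * (real s + 2)"
  shows "(score_sd \<sigma> s y)\<^sup>2 \<le> 4 * \<sigma>\<^sup>2 / (real s + 2)"
proof -
  have "(\<Sum>i<s. (y i - sample_mean s y)\<^sup>2) / (real s + 2) \<le> 2 * \<sigma>\<^sup>2"
    using order_trans[OF sum_sq_sample_mean_le assms] by (simp add: field_simps)
  then show ?thesis
    unfolding score_sd_sq by (intro divide_right_mono) auto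
qed

lemma score_tail_pos: "0 < score_tail \<sigma> \<tau> s y"
  by (simp add: score_tail_def gauss_tail_pos)

lemma score_tail_le_1: "score_tail \<sigma> \<tau> s y \<le> 1"
  by (simp add: score_tail_def gauss_tail_le_1)

text \<open>Common exponent of the two favourable cases: arm \<open>k\<close> concentrated below the
  threshold and arm 1 concentrated above it. The variance bound
  \<open>4 * \<sigma>\<^sup>2 / (s + 2)\<close> accounts for the 8.\<close>

lemma exp_deviation_le:
  assumes "0 < \<sigma>" and rss: "(\<Sum>i<s. (y i - c)\<^sup>2) \<le> 2 * \<sigma>\<^sup>2 * (real s + 2)"
    and d: "0 \<le> d" "d \<le> \<bar>x\<bar>"
  shows "exp (- (x / score_sd \<sigma> s y)\<^sup>2 / 2) \<le> exp (- (d\<^sup>2 * (real s + 2) / (8 * \<sigma>\<^sup>2)))"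
proof -
  have v: "0 < (score_sd \<sigma> s y)\<^sup>2" using score_sd_pos[OF assms(1), of s y] by simp
  have "d\<^sup>2 * (real s + 2) / (4 * \<sigma>\<^sup>2) = d\<^sup>2 / (4 * \<sigma>\<^sup>2 / (real s + 2))"
    using assms(1) by (simp add: field_simps)
  also have "\<dots> \<le> d\<^sup>2 / (score_sd \<sigma> s y)\<^sup>2"
    using v assms(1) by (intro divide_left_mono score_sd_sq_le[OF rss] mult_pos_pos) auto
  also have "\<dots> \<le> x\<^sup>2 / (score_sd \<sigma> s y)\<^sup>2"
    using power_mono[OF d(2,1), of 2] by (intro divide_right_mono) auto
  finally show ?thesis
    by (simp add: power_divide field_simps)
qed

lemma score_tail_le:
  assumes "0 < \<sigma>" and "(\<Sum>i<s. (y i - c)\<^sup>2) \<le> 2 * \<sigma>\<^sup>2 * (real s + 2)"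
    and "0 \<le> d" "d \<le> \<tau> - sample_mean s y"
  shows "score_tail \<sigma> \<tau> s y \<le> exp (- (d\<^sup>2 * (real s + 2) / (8 * \<sigma>\<^sup>2)))"
proof -
  have "score_tail \<sigma> \<tau> s y \<le> exp (- ((\<tau> - sample_mean s y) / score_sd \<sigma> s y)\<^sup>2 / 2) / 2"
    unfolding score_tail_def using assms score_sd_pos[OF assms(1), of s y]
    by (intro gauss_tail_le_exp) auto
  also have "\<dots> \<le> exp (- ((\<tau> - sample_mean s y) / score_sd \<sigma> s y)\<^sup>2 / 2)"
    by simp
  also have "\<dots> \<le> exp (- (d\<^sup>2 * (real s + 2) / (8 * \<sigma>\<^sup>2)))"
    using assms by (intro exp_deviation_le) auto
  finally show ?thesis .
qed

text \<open>The two regimes of the inverse selection probability of the optimal arm: if the sample mean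
  exceeds the threshold, large residuals hurt; if it falls short, the pseudo residuals
  alone guarantee enough variance.\<close>

lemma score_odds_above:
  assumes "0 < \<sigma>" "\<tau> \<le> sample_mean s y"
  shows "1 / score_tail \<sigma> \<tau> s y - 1 \<le> 1"
    and "(\<Sum>i<s. (y i - c)\<^sup>2) \<le> 2 * \<sigma>\<^sup>2 * (real s + 2) \<Longrightarrow> 0 \<le> d \<Longrightarrow> d \<le> sample_mean s y - \<tau> \<Longrightarrow>
      1 / score_tail \<sigma> \<tau> s y - 1 \<le> exp (- (d\<^sup>2 * (real s + 2) / (8 * \<sigma>\<^sup>2)))"
proof -
  have "(\<tau> - sample_mean s y) / score_sd \<sigma> s y \<le> 0"
    using assms score_sd_pos[OF assms(1), of s y] by (simp add: divide_nonpos_pos)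
  from gauss_tail_odds_nonpos[OF this]
  have *: "1 / score_tail \<sigma> \<tau> s y - 1 \<le> exp (- ((\<tau> - sample_mean s y) / score_sd \<sigma> s y)\<^sup>2 / 2)"
    by (simp add: score_tail_def)
  then show "1 / score_tail \<sigma> \<tau> s y - 1 \<le> 1"
    by (rule order_trans) simp
  assume "(\<Sum>i<s. (y i - c)\<^sup>2) \<le> 2 * \<sigma>\<^sup>2 * (real s + 2)" "0 \<le> d" "d \<le> sample_mean s y - \<tau>"
  then show "1 / score_tail \<sigma> \<tau> s y - 1 \<le> exp (- (d\<^sup>2 * (real s + 2) / (8 * \<sigma>\<^sup>2)))"
    using assms by (intro order_trans[OF * exp_deviation_le]) auto
qed

lemma score_odds_below:
  assumes "0 < \<sigma>" "sample_mean s y \<le> \<tau>"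
  shows "1 / score_tail \<sigma> \<tau> s y - 1 \<le>
    2 * sqrt 3 * exp (3/8 * (\<tau> - sample_mean s y)\<^sup>2 * (real s + 2) / \<sigma>\<^sup>2)"
proof -
  let ?x = "(\<tau> - sample_mean s y) / score_sd \<sigma> s y"
  have "0 \<le> ?x"
    using assms score_sd_pos[OF assms(1), of s y] by simp
  from gauss_tail_odds_nonneg[OF this]
  have *: "1 / score_tail \<sigma> \<tau> s y - 1 \<le> 2 * sqrt 3 * exp (3/4 * ?x\<^sup>2)"
    by (simp add: score_tail_def)
  \<comment> \<open>Only the variance supplied by the pseudo residuals is used, so no event on the
    rewards has to be excluded.\<close>
  have "?x\<^sup>2 \<le> (\<tau> - sample_mean s y)\<^sup>2 / (2 * \<sigma>\<^sup>2 / (real s + 2))"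
    unfolding power_divide using score_sd_pos[OF assms(1), of s y] assms(1)
    by (intro divide_left_mono score_sd_sq_ge mult_pos_pos) auto
  from mult_left_mono[OF this, of "3/4"]
  have "3/4 * ?x\<^sup>2 \<le> 3/8 * (\<tau> - sample_mean s y)\<^sup>2 * (real s + 2) / \<sigma>\<^sup>2"
    by (simp add: mult_ac)
  then show ?thesis
    by (intro order_trans[OF *] mult_left_mono) auto
qed

section \<open>Measurability and conditional law of the index\<close>

lemma borel_measurable_sample_mean [measurable (raw)]:
  assumes [measurable]: "\<And>i. (\<lambda>x. y x i) \<in> borel_measurable N"
  shows "(\<lambda>x. sample_mean s (y x)) \<in> borel_measurable N"
  unfolding sample_mean_def by measurable

lemma borel_measurable_residual [measurable (raw)]:
  assumes [measurable]: "\<And>i. (\<lambda>x. y x i) \<in> borel_measurable N"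
  shows "(\<lambda>x. residual \<sigma> s (y x) i) \<in> borel_measurable N"
  unfolding residual_def by measurable

lemma borel_measurable_score [measurable (raw)]:
  assumes [measurable]: "\<And>i. (\<lambda>x. y x i) \<in> borel_measurable N" "\<And>i. (\<lambda>x. w x i) \<in> borel_measurable N"
  shows "(\<lambda>x. score \<sigma> s (y x) (w x)) \<in> borel_measurable N"
  unfolding score_def by measurable

lemma borel_measurable_score_tail [measurable (raw)]:
  assumes [measurable]: "\<And>i. (\<lambda>x. y x i) \<in> borel_measurable N"
  shows "(\<lambda>x. score_tail \<sigma> \<tau> s (y x)) \<in> borel_measurable N"
  unfolding score_tail_def score_sd_def by measurable

text \<open>A vanishing coefficient would give a degenerate normal law without density, so the sum
  is first restricted to the nonzero coefficients.\<close>

lemma (in prob_space) distributed_linear_combination_std_normal: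
  fixes w :: "nat \<Rightarrow> 'a \<Rightarrow> real" and c :: "nat \<Rightarrow> real"
  assumes ind: "indep_vars (\<lambda>_. borel) w UNIV"
    and w: "\<And>i. distributed M lborel (w i) std_normal_density"
    and "finite I" and c: "\<exists>i\<in>I. c i \<noteq> 0"
  shows "distributed M lborel (\<lambda>\<omega>. \<Sum>i\<in>I. w i \<omega> * c i) (normal_density 0 (sqrt (\<Sum>i\<in>I. (c i)\<^sup>2)))"
proof -
  define J where "J = {i \<in> I. c i \<noteq> 0}"
  have J: "finite J" "J \<noteq> {}" using assms by (auto simp: J_def)
  have *: "(\<Sum>i\<in>I. w i \<omega> * c i) = (\<Sum>i\<in>J. w i \<omega> * c i)" for \<omega>
    using assms(3) by (intro sum.mono_neutral_right) (auto simp: J_def)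
  have **: "(\<Sum>i\<in>I. (c i)\<^sup>2) = (\<Sum>i\<in>J. \<bar>c i\<bar>\<^sup>2)"
    unfolding power2_abs using assms(3) by (intro sum.mono_neutral_right) (auto simp: J_def)
  have "distributed M lborel (\<lambda>\<omega>. w i \<omega> * c i) (normal_density 0 \<bar>c i\<bar>)" if "i \<in> J" for i
    using normal_density_affine[OF w, of "c i" 0 i] that by (simp add: J_def mult.commute)
  moreover have "indep_vars (\<lambda>_. borel) (\<lambda>i \<omega>. w i \<omega> * c i) J"
    by (rule indep_vars_compose2[where Y="\<lambda>i x. x * c i", OF indep_vars_subset[OF ind]]) auto
  ultimately have "distributed M lborel (\<lambda>\<omega>. \<Sum>i\<in>J. w i \<omega> * c i)
      (normal_density (\<Sum>i\<in>J. 0) (sqrt (\<Sum>i\<in>J. \<bar>c i\<bar>\<^sup>2)))"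
    using J by (intro sum_indep_normal) (auto simp: J_def)
  then show ?thesis unfolding * ** by simp
qed

text \<open>For fixed rewards the score is an affine function of a Gaussian linear combination of
  the weights; standardising it gives the tail.\<close>

lemma (in prob_space) emeasure_score_ge:
  fixes w :: "nat \<Rightarrow> 'a \<Rightarrow> real"
  assumes "0 < \<sigma>" and ind: "indep_vars (\<lambda>_. borel) w UNIV"
    and w: "\<And>i. distributed M lborel (w i) std_normal_density"
  shows "emeasure M {\<omega> \<in> space M. \<tau> \<le> score \<sigma> s y (\<lambda>i. w i \<omega>)} = ennreal (score_tail \<sigma> \<tau> s y)"
proof -
  let ?r = "residual \<sigma> s y" and ?m = "sample_mean s y"
  define v where "v = sqrt (\<Sum>i<s + 2. (?r i)\<^sup>2)"
  have v: "0 < v" "score_sd \<sigma> s y = v / (real s + 2)"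
    using score_sd_pos[OF assms(1), of s y] by (auto simp: score_sd_def v_def zero_less_divide_iff)
  have "distributed M lborel (\<lambda>\<omega>. \<Sum>i<s + 2. w i \<omega> * ?r i) (normal_density 0 v)"
    unfolding v_def using assms(1)
    \<comment> \<open>The pseudo residual at index \<open>s\<close> is positive, so the linear
      combination is not degenerate.\<close>
    by (intro distributed_linear_combination_std_normal ind w bexI[of _ s]) (auto simp: residual_def)
  then have "distributed M lborel (\<lambda>\<omega>. ((\<Sum>i<s + 2. w i \<omega> * ?r i) - 0) / v) std_normal_density"
    using v by (subst (asm) normal_standard_normal_convert) auto
  from emeasure_std_normal_ge[OF this, of "(\<tau> - ?m) / score_sd \<sigma> s y"]
  have "emeasure M {\<omega> \<in> space M. (\<tau> - ?m) / score_sd \<sigma> s y \<le> ((\<Sum>i<s + 2. w i \<omega> * ?r i) - 0) / v} =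
    ennreal (score_tail \<sigma> \<tau> s y)"
    by (simp add: score_tail_def)
  moreover have "(\<tau> - ?m) / score_sd \<sigma> s y \<le> (S - 0) / v \<longleftrightarrow> \<tau> \<le> ?m + S / (real s + 2)" for S
  proof -
    have "(\<tau> - ?m) / score_sd \<sigma> s y \<le> (S - 0) / v \<longleftrightarrow> (\<tau> - ?m) * (real s + 2) / v \<le> S / v"
      by (simp add: v(2))
    also have "\<dots> \<longleftrightarrow> (\<tau> - ?m) * (real s + 2) \<le> S"
      using v(1) by (simp add: divide_le_cancel)
    also have "\<dots> \<longleftrightarrow> \<tau> \<le> ?m + S / (real s + 2)"
      by (auto simp: field_simps)
    finally show ?thesis .
  qed
  ultimately show ?thesis
    unfolding score_def by simp
qed

lemma (in prob_space) emeasure_score_less: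
  fixes w :: "nat \<Rightarrow> 'a \<Rightarrow> real"
  assumes "0 < \<sigma>" and ind: "indep_vars (\<lambda>_. borel) w UNIV"
    and w: "\<And>i. distributed M lborel (w i) std_normal_density"
  shows "emeasure M {\<omega> \<in> space M. score \<sigma> s y (\<lambda>i. w i \<omega>) < \<tau>} = ennreal (1 - score_tail \<sigma> \<tau> s y)"
proof -
  have [measurable]: "random_variable borel (w i)" for i
    using w[of i] by (simp add: distributed_def)
  have "{\<omega> \<in> space M. score \<sigma> s y (\<lambda>i. w i \<omega>) < \<tau>} =
      space M - {\<omega> \<in> space M. \<tau> \<le> score \<sigma> s y (\<lambda>i. w i \<omega>)}"
    by auto
  also have "emeasure M \<dots> = emeasure M (space M) - emeasure M {\<omega> \<in> space M. \<tau> \<le> score \<sigma> s y (\<lambda>i. w i \<omega>)}"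
    by (intro emeasure_compl) (auto simp: emeasure_score_ge[OF assms])
  also have "\<dots> = ennreal (1 - score_tail \<sigma> \<tau> s y)"
    unfolding emeasure_score_ge[OF assms] emeasure_space_1
    using score_tail_pos[of \<sigma> \<tau> s y] by (simp add: ennreal_minus ennreal_1[symmetric] del: ennreal_1)
  finally show ?thesis .
qed

section \<open>Histories\<close>

definition pulled_arm ::
  "nat \<Rightarrow> real \<Rightarrow> (nat \<Rightarrow> nat \<Rightarrow> real) \<Rightarrow> (nat \<Rightarrow> nat \<Rightarrow> nat \<Rightarrow> real) \<Rightarrow> nat \<Rightarrow> nat" where
  "pulled_arm K \<sigma> X W n = last (reboot_hist K \<sigma> X W (Suc n))"

lemma reboot_hist_Suc: "reboot_hist K \<sigma> X W (Suc n) = reboot_hist K \<sigma> X W n @ [pulled_arm K \<sigma> X W n]"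
  by (simp add: pulled_arm_def Let_def)

lemma pulled_arm_initial: "n < K \<Longrightarrow> pulled_arm K \<sigma> X W n = n + 1"
  by (simp add: pulled_arm_def Let_def)

lemma pulled_arm_argmax:
  "K \<le> n \<Longrightarrow> pulled_arm K \<sigma> X W n = argmax_arm K (reboot_idx \<sigma> X W (reboot_hist K \<sigma> X W n) n)"
  by (simp add: pulled_arm_def Let_def)

lemma pulls_reboot_hist_Suc:
  "pulls (reboot_hist K \<sigma> X W (Suc n)) k =
    pulls (reboot_hist K \<sigma> X W n) k + (if pulled_arm K \<sigma> X W n = k then 1 else 0)"
  unfolding reboot_hist_Suc by (simp add: pulls_def)

lemma pulls_reboot_hist_le: "pulls (reboot_hist K \<sigma> X W n) k \<le> n"
proof (induction n)
  case (Suc n) then show ?case unfolding pulls_reboot_hist_Suc by simp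
qed (simp add: pulls_def)

lemma pulls_reboot_hist_pos:
  assumes "k \<in> {1..K}" "K \<le> n"
  shows "1 \<le> pulls (reboot_hist K \<sigma> X W n) k"
proof -
  have "k \<le> n" using assms by auto
  then show ?thesis
  proof (induction n rule: dec_induct)
    case base
    \<comment> \<open>Arms count from 1 and rounds from 0, so arm \<open>k\<close> has its initial
      pull in round \<open>k - 1\<close>.\<close>
    have "pulled_arm K \<sigma> X W (k - 1) = k"
      using assms by (subst pulled_arm_initial) auto
    then show ?case
      using assms pulls_reboot_hist_Suc[of K \<sigma> X W "k - 1" k] by simp
  next
    case (step n) then show ?case unfolding pulls_reboot_hist_Suc by simp
  qed
qed

lemma pulls_reboot_hist_eq_sum:
  "real (pulls (reboot_hist K \<sigma> X W n) k) = (\<Sum>m<n. if pulled_arm K \<sigma> X W m = k then 1 else 0)"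
proof (induction n)
  case (Suc n) then show ?case unfolding pulls_reboot_hist_Suc by simp
qed (simp add: pulls_def)

text \<open>The initial phase contributes at most one pull of each arm. For \<open>n < K\<close> the
  second sum is empty and the bound still holds.\<close>

lemma pulls_reboot_hist_le_sum:
  "real (pulls (reboot_hist K \<sigma> X W n) k) \<le> 1 + (\<Sum>m\<in>{K..<n}. if pulled_arm K \<sigma> X W m = k then 1 else 0)"
proof -
  let ?f = "\<lambda>m. if pulled_arm K \<sigma> X W m = k then 1 else 0 :: real"
  have "(\<Sum>m<n. ?f m) \<le> (\<Sum>m\<in>{..<K} \<union> {K..<n}. ?f m)"
    by (intro sum_mono2) auto
  also have "\<dots> = (\<Sum>m<K. ?f m) + (\<Sum>m\<in>{K..<n}. ?f m)"
    by (intro sum.union_disjoint) auto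
  also have "(\<Sum>m<K. ?f m) \<le> (\<Sum>m<K. if m = k - 1 then 1 else 0)"
    by (intro sum_mono) (auto simp: pulled_arm_initial)
  also have "\<dots> \<le> (1::real)"
    by (simp add: sum.delta)
  finally show ?thesis unfolding pulls_reboot_hist_eq_sum by simp
qed

text \<open>Each pull of \<open>k\<close> raises its count by one, so the counts met at the pulls of
  \<open>k\<close> run through 0, 1, 2, ... once each. This exchanges random rounds for sample
  sizes.\<close>

lemma sum_over_pulls:
  fixes f :: "nat \<Rightarrow> ennreal"
  shows "(\<Sum>m<n. if pulled_arm K \<sigma> X W m = k then f (pulls (reboot_hist K \<sigma> X W m) k) else 0) =
    (\<Sum>s<pulls (reboot_hist K \<sigma> X W n) k. f s)"
proof (induction n)
  case (Suc n)
  then show ?case unfolding pulls_reboot_hist_Suc by (simp add: add.commute)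
qed (simp add: pulls_def)

text \<open>After the initial phase the count is at least 1, so \<open>f 0\<close> is never charged;
  the count stays below the horizon. The random range of sample sizes is thus replaced by a fixed
  one, path by path, which permits taking expectations for each \<open>s\<close> separately.\<close>

lemma sum_over_late_pulls_le:
  fixes f :: "nat \<Rightarrow> ennreal"
  assumes "k \<in> {1..K}"
  shows "(\<Sum>m\<in>{K..<n}. if pulled_arm K \<sigma> X W m = k then f (pulls (reboot_hist K \<sigma> X W m) k) else 0) \<le>
    (\<Sum>s\<in>{1..<n}. f s)"
proof -
  let ?N = "\<lambda>m. pulls (reboot_hist K \<sigma> X W m) k"
  define g where "g s = (if s = 0 then 0 else f s)" for s
  have "(\<Sum>m\<in>{K..<n}. if pulled_arm K \<sigma> X W m = k then f (?N m) else 0) =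
      (\<Sum>m\<in>{K..<n}. if pulled_arm K \<sigma> X W m = k then g (?N m) else 0)"
  proof (intro sum.cong refl)
    fix m assume "m \<in> {K..<n}"
    then have "?N m \<noteq> 0" using pulls_reboot_hist_pos[OF assms, of m \<sigma> X W] by auto
    then show "(if pulled_arm K \<sigma> X W m = k then f (?N m) else 0) =
        (if pulled_arm K \<sigma> X W m = k then g (?N m) else 0)"
      by (simp add: g_def)
  qed
  also have "\<dots> \<le> (\<Sum>m<n. if pulled_arm K \<sigma> X W m = k then g (?N m) else 0)"
    by (intro sum_mono2) auto
  also have "\<dots> = (\<Sum>s<?N n. g s)"
    by (rule sum_over_pulls)
  also have "\<dots> \<le> (\<Sum>s<n. g s)"
    using pulls_reboot_hist_le[of K \<sigma> X W n k] by (intro sum_mono2) auto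
  also have "\<dots> = (\<Sum>s\<in>{1..<n}. f s)"
    by (intro sum.mono_neutral_cong_right) (auto simp: g_def)
  finally show ?thesis .
qed

text \<open>The history before round \<open>n\<close> ignores the weights of round \<open>n\<close>.
  Redrawing those weights therefore leaves the pull counts unchanged.\<close>

lemma reboot_hist_cong:
  assumes "\<And>m k i. m < n \<Longrightarrow> W m k i = W' m k i"
  shows "reboot_hist K \<sigma> X W n = reboot_hist K \<sigma> X W' n"
  using assms
proof (induction n)
  case (Suc n)
  then have "reboot_hist K \<sigma> X W n = reboot_hist K \<sigma> X W' n" "W n = W' n"
    by (auto simp: fun_eq_iff)
  then have "reboot_idx \<sigma> X W (reboot_hist K \<sigma> X W n) n = reboot_idx \<sigma> X W' (reboot_hist K \<sigma> X W' n) n"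
    by (intro ext) (simp add: reboot_idx_eq_score)
  with \<open>reboot_hist K \<sigma> X W n = _\<close> show ?case by (simp add: Let_def)
qed simp

lemma argmax_arm_is_max:
  assumes "1 \<le> K"
  shows "argmax_arm K f \<in> {1..K} \<and> (\<forall>j\<in>{1..K}. f j \<le> f (argmax_arm K f))"
proof -
  have "Max (f ` {1..K}) \<in> f ` {1..K}" using assms by (intro Max_in) auto
  then obtain k where k: "k \<in> {1..K}" "f k = Max (f ` {1..K})" by auto
  then have "\<forall>j\<in>{1..K}. f j \<le> f k" by simp
  with k(1) show ?thesis
    unfolding argmax_arm_def by (intro LeastI_ex[where P="\<lambda>k. k \<in> {1..K} \<and> (\<forall>j\<in>{1..K}. f j \<le> f k)"]) auto
qed

lemma argmax_arm_unique:
  assumes "k \<in> {1..K}" and "\<And>j. j \<in> {1..K} \<Longrightarrow> j \<noteq> k \<Longrightarrow> f j < f k"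
  shows "argmax_arm K f = k"
proof -
  have "f k \<le> f (argmax_arm K f)" "argmax_arm K f \<in> {1..K}"
    using argmax_arm_is_max[of K f] assms(1) by auto
  then show ?thesis using assms(2)[of "argmax_arm K f"] by force
qed

text \<open>Histories range over a countable type, so measurability of the index can be checked with
  the history, and hence the sample size, held fixed.\<close>

lemma measurable_reboot_hist [measurable (raw)]:
  assumes [measurable]: "\<And>k j. (\<lambda>x. X x k j) \<in> borel_measurable N"
    "\<And>m k i. (\<lambda>x. W x m k i) \<in> borel_measurable N"
  shows "(\<lambda>x. reboot_hist K \<sigma> (X x) (W x) n) \<in> N \<rightarrow>\<^sub>M count_space UNIV"
proof (induction n)
  case (Suc n)
  note [measurable] = Suc.IH
  define idx where "idx x = reboot_idx \<sigma> (X x) (W x) (reboot_hist K \<sigma> (X x) (W x) n) n" for x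
  have [measurable]: "(\<lambda>x. idx x k) \<in> borel_measurable N" for k
    unfolding idx_def reboot_idx_eq_score
    by (rule measurable_compose_countable[OF _ Suc.IH]) (intro borel_measurable_score assms)
  have [measurable]: "Measurable.pred N (\<lambda>x. idx x j \<le> idx x k)" for j k
    by measurable
  have [measurable]: "Measurable.pred N (\<lambda>x. k \<in> {1..K} \<and> (\<forall>j\<in>{1..K}. idx x j \<le> idx x k))" for k
    by (intro pred_intros_logic pred_intros_finite) auto
  have "(\<lambda>x. argmax_arm K (idx x)) \<in> N \<rightarrow>\<^sub>M count_space UNIV"
    unfolding argmax_arm_def by (rule measurable_Least) fact
  then have "(\<lambda>x. if n < K then n + 1 else argmax_arm K (idx x)) \<in> N \<rightarrow>\<^sub>M count_space UNIV"
    by (cases "n < K") simp_all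
  then have "(\<lambda>x. reboot_hist K \<sigma> (X x) (W x) n @ [if n < K then n + 1 else argmax_arm K (idx x)])
      \<in> N \<rightarrow>\<^sub>M count_space UNIV"
    by (rule measurable_compose_countable[rotated]) (rule measurable_compose[OF Suc.IH], simp)
  then show ?case unfolding idx_def by (simp only: reboot_hist.simps Let_def)
qed simp

lemma measurable_pulled_arm [measurable (raw)]:
  assumes [measurable]: "\<And>k j. (\<lambda>x. X x k j) \<in> borel_measurable N"
    "\<And>m k i. (\<lambda>x. W x m k i) \<in> borel_measurable N"
  shows "(\<lambda>x. pulled_arm K \<sigma> (X x) (W x) n) \<in> N \<rightarrow>\<^sub>M count_space UNIV"
  unfolding pulled_arm_def
  by (rule measurable_compose[OF measurable_reboot_hist]) simp_all

lemma measurable_pulls_reboot_hist [measurable (raw)]: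
  assumes [measurable]: "\<And>k j. (\<lambda>x. X x k j) \<in> borel_measurable N"
    "\<And>m k i. (\<lambda>x. W x m k i) \<in> borel_measurable N"
  shows "(\<lambda>x. pulls (reboot_hist K \<sigma> (X x) (W x) n) k) \<in> N \<rightarrow>\<^sub>M count_space UNIV"
  by (rule measurable_compose[OF measurable_reboot_hist]) simp_all

section \<open>Resampling the weights of one round\<close>

text \<open>This takes the place of conditional expectations. The coordinates in \<open>J\<close>
  are independent of the others, so the joint law is a product and Tonelli lets them be read from a
  second copy \<open>\<omega>'\<close> of the sample point.\<close>

lemma (in prob_space) nn_integral_resample:
  fixes Y :: "'i \<Rightarrow> 'a \<Rightarrow> real" and F :: "('i \<Rightarrow> real) \<Rightarrow> ennreal"
  assumes ind: "indep_vars (\<lambda>_. borel) Y UNIV"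
    and F [measurable]: "F \<in> borel_measurable (\<Pi>\<^sub>M i\<in>UNIV. borel)"
  shows "(\<integral>\<^sup>+\<omega>. F (\<lambda>i. Y i \<omega>) \<partial>M) =
    (\<integral>\<^sup>+\<omega>. \<integral>\<^sup>+\<omega>'. F (\<lambda>i. if i \<in> J then Y i \<omega>' else Y i \<omega>) \<partial>M \<partial>M)"
proof -
  let ?S = "\<Pi>\<^sub>M i\<in>- J. borel :: real measure" and ?T = "\<Pi>\<^sub>M i\<in>J. borel :: real measure"
  define U where "U \<omega> = restrict (\<lambda>i. Y i \<omega>) (- J)" for \<omega>
  define V where "V \<omega> = restrict (\<lambda>i. Y i \<omega>) J" for \<omega>
  define G where "G p = F (\<lambda>i. if i \<in> J then snd p i else fst p i)" for p
  have iv: "indep_var ?S U ?T V"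
    unfolding U_def V_def by (rule indep_var_restrict[OF ind]) auto
  then have [measurable]: "U \<in> M \<rightarrow>\<^sub>M ?S" "V \<in> M \<rightarrow>\<^sub>M ?T"
    and eq: "distr M ?S U \<Otimes>\<^sub>M distr M ?T V = distr M (?S \<Otimes>\<^sub>M ?T) (\<lambda>\<omega>. (U \<omega>, V \<omega>))"
    by (auto simp: indep_var_distribution_eq)
  have comp: "(\<lambda>p. if i \<in> J then snd p i else fst p i) \<in> borel_measurable (?S \<Otimes>\<^sub>M ?T)" for i
    by (cases "i \<in> J") (auto intro!: measurable_compose[OF measurable_snd measurable_component_singleton]
        measurable_compose[OF measurable_fst measurable_component_singleton])
  have "(\<lambda>p i. if i \<in> J then snd p i else fst p i) \<in> ?S \<Otimes>\<^sub>M ?T \<rightarrow>\<^sub>M (\<Pi>\<^sub>M i\<in>UNIV. borel)"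
    by (rule measurable_PiM_single') (auto intro: comp)
  then have [measurable]: "G \<in> borel_measurable (?S \<Otimes>\<^sub>M ?T)"
    unfolding G_def by (rule measurable_compose) fact
  interpret T: prob_space "distr M ?T V"
    by (rule prob_space_distr) simp
  have glue: "G (U \<omega>, V \<omega>') = F (\<lambda>i. if i \<in> J then Y i \<omega>' else Y i \<omega>)" for \<omega> \<omega>'
    unfolding G_def by (rule arg_cong[where f=F]) (auto simp: U_def V_def)
  have "(\<integral>\<^sup>+\<omega>. F (\<lambda>i. Y i \<omega>) \<partial>M) = (\<integral>\<^sup>+\<omega>. G (U \<omega>, V \<omega>) \<partial>M)"
    unfolding glue by simp
  also have "\<dots> = integral\<^sup>N (distr M ?S U \<Otimes>\<^sub>M distr M ?T V) G"
    unfolding eq by (subst nn_integral_distr) auto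
  also have "\<dots> = (\<integral>\<^sup>+u. \<integral>\<^sup>+v. G (u, v) \<partial>distr M ?T V \<partial>distr M ?S U)"
    by (rule T.nn_integral_fst[symmetric]) measurable
  also have "\<dots> = (\<integral>\<^sup>+\<omega>. \<integral>\<^sup>+v. G (U \<omega>, v) \<partial>distr M ?T V \<partial>M)"
    by (subst nn_integral_distr) (auto intro!: T.borel_measurable_nn_integral_fst)
  also have "\<dots> = (\<integral>\<^sup>+\<omega>. \<integral>\<^sup>+\<omega>'. G (U \<omega>, V \<omega>') \<partial>M \<partial>M)"
    by (intro nn_integral_cong, subst nn_integral_distr) (auto intro: measurable_compose[OF measurable_Pair1'])
  also have "\<dots> = (\<integral>\<^sup>+\<omega>. \<integral>\<^sup>+\<omega>'. F (\<lambda>i. if i \<in> J then Y i \<omega>' else Y i \<omega>) \<partial>M \<partial>M)"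
    unfolding glue ..
  finally show ?thesis .
qed

text \<open>Injectivity makes the singleton index blocks disjoint.\<close>

lemma (in prob_space) indep_vars_reindex:
  assumes "indep_vars (\<lambda>_. N) Y UNIV" and "inj f"
  shows "indep_vars (\<lambda>_. N) (\<lambda>j. Y (f j)) UNIV"
proof -
  have "indep_vars (\<lambda>j. PiM {f j} (\<lambda>_. N)) (\<lambda>j \<omega>. restrict (\<lambda>i. Y i \<omega>) {f j}) UNIV"
    using assms by (intro indep_vars_restrict) (auto simp: disjoint_family_on_def inj_def)
  then have "indep_vars (\<lambda>_. N) (\<lambda>j \<omega>. restrict (\<lambda>i. Y i \<omega>) {f j} (f j)) UNIV"
    by (rule indep_vars_compose2[where Y="\<lambda>j x. x (f j)"]) (rule measurable_component_singleton, simp)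
  then show ?thesis by simp
qed

section \<open>The Gaussian bandit model and redrawn indices\<close>

type_synonym draw = "(nat \<times> nat) + (nat \<times> nat \<times> nat)"

text \<open>Rewards (\<open>Inl (k, j)\<close>) and weights (\<open>Inr (n, k, i)\<close>) form one
  independent family, so that any block of coordinates can be redrawn given all the rest.\<close>

locale gaussian_reboot = prob_space M for M :: "'a measure" +
  fixes K :: nat and \<mu> :: "nat \<Rightarrow> real" and \<sigma> :: real
    and X :: "nat \<Rightarrow> nat \<Rightarrow> 'a \<Rightarrow> real" and W :: "nat \<Rightarrow> nat \<Rightarrow> nat \<Rightarrow> 'a \<Rightarrow> real"
  assumes sigma_gt: "3/2 < \<sigma>"
    and indep: "indep_vars (\<lambda>_. borel)
      (\<lambda>d :: draw. case d of Inl (k, j) \<Rightarrow> X k j | Inr (n, k, i) \<Rightarrow> W n k i) UNIV"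
    and X_normal: "\<And>k j. distributed M lborel (X k j) (normal_density (\<mu> k) 1)"
    and W_normal: "\<And>n k i. distributed M lborel (W n k i) std_normal_density"
begin

definition hist :: "nat \<Rightarrow> 'a \<Rightarrow> nat list" where
  "hist n \<omega> = reboot_hist K \<sigma> (\<lambda>k j. X k j \<omega>) (\<lambda>n k i. W n k i \<omega>) n"

definition arm :: "nat \<Rightarrow> 'a \<Rightarrow> nat" where
  "arm n \<omega> = pulled_arm K \<sigma> (\<lambda>k j. X k j \<omega>) (\<lambda>n k i. W n k i \<omega>) n"

definition index :: "nat \<Rightarrow> nat \<Rightarrow> 'a \<Rightarrow> real" where
  "index n k \<omega> = score \<sigma> (pulls (hist n \<omega>) k) (\<lambda>j. X k j \<omega>) (\<lambda>i. W n k i \<omega>)"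

lemma sigma_pos: "0 < \<sigma>"
  using sigma_gt by simp

lemma X_measurable [measurable]: "X k j \<in> borel_measurable M"
  using X_normal[of k j] by (simp add: distributed_def)

lemma W_measurable [measurable]: "W n k i \<in> borel_measurable M"
  using W_normal[of n k i] by (simp add: distributed_def)

lemma pulls_hist_measurable [measurable]: "(\<lambda>\<omega>. pulls (hist n \<omega>) k) \<in> M \<rightarrow>\<^sub>M count_space UNIV"
  unfolding hist_def by measurable

lemma arm_measurable [measurable]: "arm n \<in> M \<rightarrow>\<^sub>M count_space UNIV"
  unfolding arm_def by measurable

lemma index_measurable [measurable]: "index n k \<in> borel_measurable M"
  unfolding index_def by (rule measurable_compose_countable[OF _ pulls_hist_measurable]) measurable

lemma score_tail_pulls_measurable [measurable]:
  "(\<lambda>\<omega>. score_tail \<sigma> \<tau> (pulls (hist n \<omega>) k) (\<lambda>j. X l j \<omega>)) \<in> borel_measurable M"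
  by (rule measurable_compose_countable[OF _ pulls_hist_measurable]) measurable

lemma weights_indep: "indep_vars (\<lambda>_. borel) (W n k) UNIV"
  using indep_vars_reindex[OF indep, of "\<lambda>i. Inr (n, k, i)"] by (simp add: inj_on_def)

lemma rewards_indep: "indep_vars (\<lambda>_. borel) (X k) UNIV"
  using indep_vars_reindex[OF indep, of "\<lambda>j. Inl (k, j)"] by (simp add: inj_on_def)

text \<open>The conditional law of the index given everything but the weights of arm \<open>k\<close> in round \<open>n\<close>,
  expressed through integrands \<open>g\<close> that do not depend on those weights.\<close>

lemma nn_integral_index:
  fixes g :: "(draw \<Rightarrow> real) \<Rightarrow> ennreal" and \<tau> :: real
  defines "g' \<equiv> \<lambda>\<omega>. g (\<lambda>d. (case d of Inl (k, j) \<Rightarrow> X k j | Inr (n, k, i) \<Rightarrow> W n k i) \<omega>)"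
  assumes g [measurable]: "g \<in> borel_measurable (\<Pi>\<^sub>M i\<in>UNIV. borel)"
    and g_cong: "\<And>x x'. \<forall>d. (\<forall>i. d \<noteq> Inr (n, k, i)) \<longrightarrow> x d = x' d \<Longrightarrow> g x = g x'"
  shows "(\<integral>\<^sup>+\<omega>. g' \<omega> * indicator {\<omega>. \<tau> \<le> index n k \<omega>} \<omega> \<partial>M) =
      (\<integral>\<^sup>+\<omega>. g' \<omega> * ennreal (score_tail \<sigma> \<tau> (pulls (hist n \<omega>) k) (\<lambda>j. X k j \<omega>)) \<partial>M)" (is ?ge)
    and "(\<integral>\<^sup>+\<omega>. g' \<omega> * indicator {\<omega>. index n k \<omega> < \<tau>} \<omega> \<partial>M) =
      (\<integral>\<^sup>+\<omega>. g' \<omega> * ennreal (1 - score_tail \<sigma> \<tau> (pulls (hist n \<omega>) k) (\<lambda>j. X k j \<omega>)) \<partial>M)" (is ?less)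
proof -
  let ?Y = "\<lambda>d \<omega>. (case d of Inl (k, j) \<Rightarrow> X k j | Inr (n, k, i) \<Rightarrow> W n k i) \<omega>"
  \<comment> \<open>The redrawn block: all weights of arm \<open>k\<close> in round
    \<open>n\<close>.\<close>
  define J where "J = range (\<lambda>i. Inr (n, k, i) :: draw)"
  define h where "h x = reboot_hist K \<sigma> (\<lambda>k j. x (Inl (k, j))) (\<lambda>n k i. x (Inr (n, k, i))) n"
    for x :: "draw \<Rightarrow> real"
  define idx where "idx x = score \<sigma> (pulls (h x) k) (\<lambda>j. x (Inl (k, j))) (\<lambda>i. x (Inr (n, k, i)))"
    for x :: "draw \<Rightarrow> real"
  have coord: "(\<lambda>x. x d) \<in> borel_measurable (\<Pi>\<^sub>M i\<in>UNIV. borel)" for d :: draw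
    by (rule measurable_component_singleton) simp
  have idx [measurable]: "idx \<in> borel_measurable (\<Pi>\<^sub>M i\<in>UNIV. borel)"
    unfolding idx_def h_def
    by (rule measurable_compose_countable[OF _ measurable_pulls_reboot_hist])
      (intro borel_measurable_score coord)+
  have idx_eq: "idx (\<lambda>d. ?Y d \<omega>) = index n k \<omega>" for \<omega>
    by (simp add: idx_def h_def index_def hist_def)
  \<comment> \<open>Redrawing changes weights of round \<open>n\<close> only, which the first
    \<open>n\<close> rounds do not see.\<close>
  have h_eq: "h (\<lambda>d. if d \<in> J then ?Y d \<omega>' else ?Y d \<omega>) = hist n \<omega>" for \<omega> \<omega>'
    unfolding h_def hist_def by (simp add: J_def image_iff) (rule reboot_hist_cong, auto)
  have idx_resample: "idx (\<lambda>d. if d \<in> J then ?Y d \<omega>' else ?Y d \<omega>) =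
      score \<sigma> (pulls (hist n \<omega>) k) (\<lambda>j. X k j \<omega>) (\<lambda>i. W n k i \<omega>')" for \<omega> \<omega>'
    unfolding idx_def h_eq by (simp add: J_def image_iff)
  have g_resample: "g (\<lambda>d. if d \<in> J then ?Y d \<omega>' else ?Y d \<omega>) = g' \<omega>" for \<omega> \<omega>'
    unfolding g'_def by (rule g_cong) (auto simp: J_def)
  have main: "(\<integral>\<^sup>+\<omega>. g' \<omega> * indicator A (index n k \<omega>) \<partial>M) =
      (\<integral>\<^sup>+\<omega>. g' \<omega> * emeasure M {\<omega>' \<in> space M.
        score \<sigma> (pulls (hist n \<omega>) k) (\<lambda>j. X k j \<omega>) (\<lambda>i. W n k i \<omega>') \<in> A} \<partial>M)"
    if [measurable]: "A \<in> sets borel" for A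
  proof -
    have "(\<integral>\<^sup>+\<omega>. g' \<omega> * indicator A (index n k \<omega>) \<partial>M) =
        (\<integral>\<^sup>+\<omega>. (\<lambda>x. g x * indicator A (idx x)) (\<lambda>d. ?Y d \<omega>) \<partial>M)"
      by (simp add: idx_eq g'_def)
    also have "\<dots> = (\<integral>\<^sup>+\<omega>. \<integral>\<^sup>+\<omega>'. (\<lambda>x. g x * indicator A (idx x))
        (\<lambda>d. if d \<in> J then ?Y d \<omega>' else ?Y d \<omega>) \<partial>M \<partial>M)"
      by (rule nn_integral_resample[OF indep]) measurable
    also have "\<dots> = (\<integral>\<^sup>+\<omega>. \<integral>\<^sup>+\<omega>'. g' \<omega> * indicator {\<omega>' \<in> space M.
        score \<sigma> (pulls (hist n \<omega>) k) (\<lambda>j. X k j \<omega>) (\<lambda>i. W n k i \<omega>') \<in> A} \<omega>' \<partial>M \<partial>M)"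
      unfolding g_resample idx_resample by (intro nn_integral_cong) (simp add: indicator_def)
    also have "\<dots> = (\<integral>\<^sup>+\<omega>. g' \<omega> * emeasure M {\<omega>' \<in> space M.
        score \<sigma> (pulls (hist n \<omega>) k) (\<lambda>j. X k j \<omega>) (\<lambda>i. W n k i \<omega>') \<in> A} \<partial>M)"
      by (intro nn_integral_cong nn_integral_cmult_indicator) measurable
    finally show ?thesis .
  qed
  show ?ge
    using main[of "{\<tau>..}"] emeasure_score_ge[OF sigma_pos weights_indep W_normal]
    by (simp add: indicator_def)
  show ?less
    using main[of "{..<\<tau>}"] emeasure_score_less[OF sigma_pos weights_indep W_normal]
    by (simp add: indicator_def)
qed

end

section \<open>Concentration of the rewards\<close>

text \<open>The geometric series is at most \<open>1 / (exp c - 1)\<close>, and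
  \<open>c \<le> exp c - 1\<close>. Rates proportional to the squared gap thus become terms of order
  one over the squared gap.\<close>

lemma sum_exp_geometric_le:
  fixes c :: real
  assumes "0 < c"
  shows "(\<Sum>s\<in>{1..<n}. exp (- (c * real s))) \<le> 1 / c"
proof -
  let ?q = "exp (- c)"
  have q: "0 < ?q" "?q < 1" using assms by auto
  have "(\<Sum>s\<in>{1..<n}. exp (- (c * real s))) = (\<Sum>s\<in>{1..<n}. ?q ^ s)"
    by (simp add: exp_of_nat_mult[symmetric] mult.commute)
  also have "\<dots> \<le> ?q / (1 - ?q)"
  proof (cases "1 \<le> n")
    case True
    then have "(\<Sum>s\<in>{1..<n}. ?q ^ s) * (1 - ?q) = ?q - ?q ^ n"
    proof (induction n rule: dec_induct)
      case base then show ?case by simp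
    next
      case (step m)
      then show ?case by (simp add: distrib_right) (simp add: algebra_simps)
    qed
    then have "(\<Sum>s\<in>{1..<n}. ?q ^ s) * (1 - ?q) \<le> ?q" using q by simp
    then show ?thesis using q by (simp add: field_simps)
  qed (use q in simp)
  also have "\<dots> = 1 / (exp c - 1)"
    using assms by (simp add: exp_minus field_simps)
  also have "\<dots> \<le> 1 / c"
  proof -
    have "c \<le> exp c - 1" using exp_ge_add_one_self[of c] by linarith
    then show ?thesis using assms by (intro divide_left_mono) auto
  qed
  finally show ?thesis .
qed

lemma sum_half_powers_le: "(\<Sum>s\<in>{1..<n}. (1/2::real) ^ s) \<le> 1"
proof -
  have "(\<Sum>s\<in>{1..<n}. (1/2::real) ^ s) \<le> 1 - (1/2) ^ (n - 1)"
  proof (induction n)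
    case (Suc n) then show ?case by (cases n) auto
  qed simp
  then show ?thesis by (rule order_trans) simp
qed

text \<open>Here \<open>m\<close> is the true mean. Centring the squares at \<open>m\<close> rather
  than at the sample mean keeps the summands independent, and \<open>sum_sq_sample_mean_le\<close>
  passes the bound on to the residuals.\<close>

definition concentrated :: "real \<Rightarrow> real \<Rightarrow> real \<Rightarrow> nat \<Rightarrow> (nat \<Rightarrow> real) \<Rightarrow> bool" where
  "concentrated \<sigma> m d s y \<longleftrightarrow>
    (\<Sum>i<s. (y i - m)\<^sup>2) \<le> 2 * \<sigma>\<^sup>2 * (real s + 2) \<and> \<bar>sample_mean s y - m\<bar> \<le> d"

lemma pred_concentrated [measurable (raw)]:
  assumes [measurable]: "\<And>i. (\<lambda>x. y x i) \<in> borel_measurable N"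
  shows "Measurable.pred N (\<lambda>x. concentrated \<sigma> m d s (y x))"
  unfolding concentrated_def by measurable

context gaussian_reboot
begin

lemma centered_reward_normal: "distributed M lborel (\<lambda>\<omega>. X k j \<omega> - \<mu> k) std_normal_density"
  using X_normal[of k j] by (subst (asm) normal_standard_normal_convert) auto

lemma centered_rewards_indep: "indep_vars (\<lambda>_. borel) (\<lambda>j \<omega>. X k j \<omega> - \<mu> k) UNIV"
  by (rule indep_vars_compose2[where Y="\<lambda>j x. x - \<mu> k", OF rewards_indep]) auto

lemma standardized_mean_normal:
  assumes "1 \<le> s"
  shows "distributed M lborel (\<lambda>\<omega>. sqrt (real s) * (sample_mean s (\<lambda>j. X k j \<omega>) - \<mu> k)) std_normal_density"
proof -
  have "sqrt (real s) * (sample_mean s (\<lambda>j. X k j \<omega>) - \<mu> k) =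
      (\<Sum>i<s. (X k i \<omega> - \<mu> k) * (1 / sqrt (real s)))" for \<omega>
  proof -
    have "(\<Sum>i<s. (X k i \<omega> - \<mu> k) * (1 / sqrt (real s))) = ((\<Sum>i<s. X k i \<omega>) - real s * \<mu> k) / sqrt (real s)"
      by (simp add: sum_distrib_right[symmetric] sum_divide_distrib[symmetric] sum_subtractf)
    also have "\<dots> = sqrt (real s) * (sample_mean s (\<lambda>j. X k j \<omega>) - \<mu> k)"
    proof -
      have "real s = sqrt (real s) * sqrt (real s)" "sqrt (real s) \<noteq> 0" using assms by auto
      then show ?thesis
        using assms by (simp add: sample_mean_def divide_simps) (simp add: algebra_simps)
    qed
    finally show ?thesis ..
  qed
  moreover have "distributed M lborel (\<lambda>\<omega>. \<Sum>i<s. (X k i \<omega> - \<mu> k) * (1 / sqrt (real s)))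
      (normal_density 0 (sqrt (\<Sum>i<s. (1 / sqrt (real s))\<^sup>2)))"
    using assms
    by (intro distributed_linear_combination_std_normal centered_rewards_indep centered_reward_normal)
      (auto intro: exI[of _ 0])
  moreover have "sqrt (\<Sum>i<s. (1 / sqrt (real s))\<^sup>2) = 1"
    using assms by (simp add: power_divide)
  ultimately show ?thesis by simp
qed

text \<open>A Chernoff bound with parameter 1/4: each squared deviation has exponential moment
  \<open>sqrt 2\<close>, and \<open>\<sigma> > 3/2\<close> makes the resulting factor per reward at
  most 1/2.\<close>

lemma emeasure_sum_sq_large:
  "emeasure M {\<omega> \<in> space M. 2 * \<sigma>\<^sup>2 * (real s + 2) < (\<Sum>i<s. (X k i \<omega> - \<mu> k)\<^sup>2)} \<le> ennreal ((1/2) ^ s)"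
proof -
  let ?S = "\<lambda>\<omega>. \<Sum>i<s. (X k i \<omega> - \<mu> k)\<^sup>2"
  have "emeasure M {\<omega> \<in> space M. 2 * \<sigma>\<^sup>2 * (real s + 2) < ?S \<omega>} =
      (\<integral>\<^sup>+\<omega>. indicator {\<omega> \<in> space M. 2 * \<sigma>\<^sup>2 * (real s + 2) < ?S \<omega>} \<omega> \<partial>M)"
    by simp
  also have "\<dots> \<le> (\<integral>\<^sup>+\<omega>. ennreal (exp (- (\<sigma>\<^sup>2 * real s / 2))) * (\<Prod>i<s. ennreal (exp (1/4 * (X k i \<omega> - \<mu> k)\<^sup>2))) \<partial>M)"
  proof (intro nn_integral_mono)
    fix \<omega>
    have "exp (- (\<sigma>\<^sup>2 * real s / 2)) * (\<Prod>i<s. exp (1/4 * (X k i \<omega> - \<mu> k)\<^sup>2)) = exp (?S \<omega> / 4 - \<sigma>\<^sup>2 * real s / 2)"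
      by (simp add: exp_sum[symmetric] exp_add[symmetric] sum_divide_distrib)
    moreover have "1 \<le> exp (?S \<omega> / 4 - \<sigma>\<^sup>2 * real s / 2)" if "2 * \<sigma>\<^sup>2 * (real s + 2) < ?S \<omega>"
    proof -
      have "2 * \<sigma>\<^sup>2 * real s \<le> 2 * \<sigma>\<^sup>2 * (real s + 2)" by (intro mult_left_mono) auto
      with that have "2 * \<sigma>\<^sup>2 * real s \<le> ?S \<omega>" by linarith
      then show ?thesis by (simp add: mult_ac)
    qed
    ultimately show "indicator {\<omega> \<in> space M. 2 * \<sigma>\<^sup>2 * (real s + 2) < ?S \<omega>} \<omega> \<le>
        ennreal (exp (- (\<sigma>\<^sup>2 * real s / 2))) * (\<Prod>i<s. ennreal (exp (1/4 * (X k i \<omega> - \<mu> k)\<^sup>2)))"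
      by (auto simp: indicator_def prod_ennreal ennreal_mult[symmetric] prod_nonneg
          simp del: ennreal_1 simp flip: ennreal_1)
  qed
  also have "\<dots> = ennreal (exp (- (\<sigma>\<^sup>2 * real s / 2))) * (\<integral>\<^sup>+\<omega>. (\<Prod>i<s. ennreal (exp (1/4 * (X k i \<omega> - \<mu> k)\<^sup>2))) \<partial>M)"
    by (rule nn_integral_cmult) measurable
  also have "(\<integral>\<^sup>+\<omega>. (\<Prod>i<s. ennreal (exp (1/4 * (X k i \<omega> - \<mu> k)\<^sup>2))) \<partial>M) =
      (\<Prod>i<s. \<integral>\<^sup>+\<omega>. ennreal (exp (1/4 * (X k i \<omega> - \<mu> k)\<^sup>2)) \<partial>M)"
    by (intro indep_vars_nn_integral indep_vars_compose2[where Y="\<lambda>i x. ennreal (exp (1/4 * x\<^sup>2))",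
        OF indep_vars_subset[OF centered_rewards_indep]]) auto
  also have "\<dots> = (\<Prod>i<s. ennreal (1 / sqrt (1 - 2 * (1/4))))"
    by (intro prod.cong refl nn_integral_exp_square_normal centered_reward_normal) simp
  also have "\<dots> = ennreal (sqrt 2 ^ s)"
    by (simp add: real_sqrt_divide ennreal_power)
  also have "ennreal (exp (- (\<sigma>\<^sup>2 * real s / 2))) * \<dots> = ennreal ((sqrt 2 * exp (- (\<sigma>\<^sup>2 / 2))) ^ s)"
    by (simp add: ennreal_mult[symmetric] power_mult_distrib exp_of_nat_mult[symmetric] mult_ac)
  also have "\<dots> \<le> ennreal ((1/2) ^ s)"
  proof (intro ennreal_leI power_mono)
    \<comment> \<open>The target is \<open>8 \<le> exp (9/4)\<close>. The quadratic Taylor bound is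
      applied at 9/16, where it is sharp enough to survive the fourth power.\<close>
    have "(8::real) \<le> (172/100) ^ 4" by (simp add: power_numeral_reduce field_simps)
    also have "\<dots> \<le> exp (9/16) ^ 4"
      using exp_lower_Taylor_quadratic[of "9/16"] by (intro power_mono) (auto simp: power2_eq_square)
    also have "\<dots> = exp (9/4)" by (simp add: exp_of_nat_mult[symmetric])
    also have "\<dots> \<le> exp (\<sigma>\<^sup>2)"
      using power_mono[of "3/2" \<sigma> 2] sigma_gt by (simp add: power2_eq_square)
    finally have "8 \<le> exp (\<sigma>\<^sup>2)" .
    moreover have "exp (- (\<sigma>\<^sup>2 / 2)) ^ 2 = exp (- \<sigma>\<^sup>2)"
      using exp_of_nat_mult[of 2 "- (\<sigma>\<^sup>2 / 2)"] by simp
    ultimately have "(sqrt 2 * exp (- (\<sigma>\<^sup>2 / 2)))\<^sup>2 \<le> (1/2)\<^sup>2"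
      by (simp add: power_mult_distrib exp_minus power_divide field_simps)
    then show "sqrt 2 * exp (- (\<sigma>\<^sup>2 / 2)) \<le> 1/2"
      by (rule power2_le_imp_le) simp
  qed simp
  finally show ?thesis .
qed

text \<open>A union bound over a large sum of squares and the two one-sided deviations of the mean;
  the factor 1/2 in each tail absorbs the two sides.\<close>

lemma emeasure_not_concentrated:
  assumes "1 \<le> s" "0 \<le> d"
  shows "emeasure M {\<omega> \<in> space M. \<not> concentrated \<sigma> (\<mu> k) d s (\<lambda>j. X k j \<omega>)} \<le>
    ennreal ((1/2) ^ s + exp (- (d\<^sup>2 / 2 * real s)))"
proof -
  let ?Z = "\<lambda>\<omega>. sqrt (real s) * (sample_mean s (\<lambda>j. X k j \<omega>) - \<mu> k)"
  define x where "x = sqrt (real s) * d"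
  have x: "0 \<le> x" "x\<^sup>2 = real s * d\<^sup>2" using assms by (auto simp: x_def power_mult_distrib)
  let ?A = "{\<omega> \<in> space M. 2 * \<sigma>\<^sup>2 * (real s + 2) < (\<Sum>i<s. (X k i \<omega> - \<mu> k)\<^sup>2)}"
  let ?B = "{\<omega> \<in> space M. x \<le> ?Z \<omega>}" and ?C = "{\<omega> \<in> space M. x \<le> - ?Z \<omega>}"
  note Z = standardized_mean_normal[OF assms(1), of k]
  have "{\<omega> \<in> space M. \<not> concentrated \<sigma> (\<mu> k) d s (\<lambda>j. X k j \<omega>)} \<subseteq> ?A \<union> (?B \<union> ?C)"
  proof -
    have "x \<le> sqrt (real s) * u \<or> x \<le> - (sqrt (real s) * u)" if "d < \<bar>u\<bar>" for u
    proof -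
      have "x \<le> sqrt (real s) * \<bar>u\<bar>" using that by (auto simp: x_def intro: mult_left_mono)
      then show ?thesis by (cases "0 \<le> u") auto
    qed
    then show ?thesis by (auto simp: concentrated_def not_le)
  qed
  then have "emeasure M {\<omega> \<in> space M. \<not> concentrated \<sigma> (\<mu> k) d s (\<lambda>j. X k j \<omega>)} \<le> emeasure M (?A \<union> (?B \<union> ?C))"
    by (rule emeasure_mono) measurable
  also have "\<dots> \<le> emeasure M ?A + emeasure M (?B \<union> ?C)"
    by (rule emeasure_subadditive) measurable
  also have "\<dots> \<le> emeasure M ?A + (emeasure M ?B + emeasure M ?C)"
    by (intro add_left_mono emeasure_subadditive) measurable
  also have "\<dots> \<le> ennreal ((1/2) ^ s) + (ennreal (exp (- x\<^sup>2 / 2) / 2) + ennreal (exp (- x\<^sup>2 / 2) / 2))"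
    unfolding emeasure_std_normal_ge[OF Z] emeasure_std_normal_ge[OF distributed_std_normal_uminus[OF Z]]
    by (intro add_mono emeasure_sum_sq_large ennreal_leI gauss_tail_le_exp x)
  also have "\<dots> = ennreal ((1/2) ^ s + exp (- (d\<^sup>2 / 2 * real s)))"
    by (simp add: x(2) mult_ac flip: ennreal_plus)
  finally show ?thesis .
qed

text \<open>Three cases. If the mean is above \<open>\<tau>\<close> and the rewards are
  concentrated, the odds are at most \<open>p\<close>. If it is above \<open>\<tau>\<close> without
  concentration, the odds are at most 1 and are charged to \<open>?bad\<close>. If it is below
  \<open>\<tau>\<close>, the odds are at most \<open>q\<close> times a Gaussian exponential moment
  with expectation \<open>B\<close>.\<close>

lemma nn_integral_score_odds_le:
  fixes D \<tau> :: real
  assumes s: "1 \<le> s" and D: "0 < D" and \<tau>: "\<tau> = \<mu> k - D / 2"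
  defines "B \<equiv> 1 / sqrt (1 - 9/4 / \<sigma>\<^sup>2)"
  shows "(\<integral>\<^sup>+\<omega>. ennreal (1 / score_tail \<sigma> \<tau> s (\<lambda>j. X k j \<omega>) - 1) \<partial>M) \<le>
    ennreal ((1/2) ^ s + exp (- (D\<^sup>2 / 32 * real s)) + exp (- (D\<^sup>2 / (128 * \<sigma>\<^sup>2) * real s)) +
      2 * sqrt 3 * B * exp (- (3 * D\<^sup>2 / (32 * \<sigma>\<^sup>2) * real s)))"
proof -
  let ?m = "\<lambda>\<omega>. sample_mean s (\<lambda>j. X k j \<omega>)"
  let ?Z = "\<lambda>\<omega>. sqrt (real s) * (?m \<omega> - \<mu> k)"
  \<comment> \<open>The rate is 3/8 from \<open>score_odds_below\<close> times 3 from
    \<open>s + 2 \<le> 3 * s\<close>. Being below 1/2 is what \<open>\<sigma> > 3/2\<close>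
    provides.\<close>
  let ?a = "9/8 / \<sigma>\<^sup>2"
  let ?bad = "{\<omega> \<in> space M. \<not> concentrated \<sigma> (\<mu> k) (D/4) s (\<lambda>j. X k j \<omega>)}"
  define p where "p = exp (- (D\<^sup>2 / (128 * \<sigma>\<^sup>2) * real s))"
  define q where "q = 2 * sqrt 3 * exp (- (3 * D\<^sup>2 / (32 * \<sigma>\<^sup>2) * real s))"
  note Z = standardized_mean_normal[OF s, of k]
  have s2: "9/4 < \<sigma>\<^sup>2" using power_strict_mono[of "3/2" \<sigma> 2] sigma_gt by (simp add: power2_eq_square)
  have a: "?a < 1/2" using s2 by (simp add: divide_less_eq)
  have B: "1 / sqrt (1 - 2 * ?a) = B" by (simp add: B_def)
  have nonneg: "0 \<le> p" "0 \<le> q" by (auto simp: p_def q_def)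
  have "(\<integral>\<^sup>+\<omega>. ennreal (1 / score_tail \<sigma> \<tau> s (\<lambda>j. X k j \<omega>) - 1) \<partial>M) \<le>
      (\<integral>\<^sup>+\<omega>. indicator ?bad \<omega> + (ennreal p + ennreal q * ennreal (exp (?a * (?Z \<omega>)\<^sup>2))) \<partial>M)"
  proof (intro nn_integral_mono)
    fix \<omega> assume \<omega>: "\<omega> \<in> space M"
    let ?y = "\<lambda>j. X k j \<omega>"
    have "1 / score_tail \<sigma> \<tau> s ?y - 1 \<le> indicator ?bad \<omega> + (p + q * exp (?a * (?Z \<omega>)\<^sup>2))"
    proof (cases "\<tau> \<le> ?m \<omega>")
      case True
      show ?thesis
      proof (cases "concentrated \<sigma> (\<mu> k) (D/4) s ?y")
        case c: True
        then have "\<bar>?m \<omega> - \<mu> k\<bar> \<le> D / 4" by (simp add: concentrated_def)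
        \<comment> \<open>\<open>\<tau>\<close> lies \<open>D / 2\<close> below the true mean, of
          which concentration gives up \<open>D / 4\<close>.\<close>
        then have "D / 4 \<le> ?m \<omega> - \<tau>" using \<tau> by linarith
        then have "1 / score_tail \<sigma> \<tau> s ?y - 1 \<le> exp (- ((D/4)\<^sup>2 * (real s + 2) / (8 * \<sigma>\<^sup>2)))"
          using c D True by (intro score_odds_above(2)[where c="\<mu> k"] sigma_pos) (auto simp: concentrated_def)
        also have "\<dots> \<le> p"
          using sigma_pos by (simp add: p_def power_divide field_simps)
        finally show ?thesis using nonneg c by (simp add: add_increasing2)
      next
        case False
        then show ?thesis
          using score_odds_above(1)[OF sigma_pos True] nonneg \<omega> by (simp add: add_increasing2)
      qed
    next
      case False
      define u where "u = \<mu> k - ?m \<omega>"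
      have u: "D / 2 \<le> u" using False by (simp add: u_def \<tau>)
      \<comment> \<open>With \<open>u \<ge> D / 2\<close> the square
        \<open>(u - D / 2)\<^sup>2\<close> falls short of \<open>u\<^sup>2\<close> by at least
        \<open>D\<^sup>2 / 4\<close>. This gain is the source of the decay in
        \<open>s\<close>.\<close>
      have "(\<tau> - ?m \<omega>)\<^sup>2 * (real s + 2) \<le> (u\<^sup>2 - D\<^sup>2 / 4) * (real s + 2)"
      proof (intro mult_right_mono)
        have "D * (D / 2) \<le> D * u" using u D by (intro mult_left_mono) auto
        then show "(\<tau> - ?m \<omega>)\<^sup>2 \<le> u\<^sup>2 - D\<^sup>2 / 4"
          by (simp add: \<tau> u_def power2_eq_square algebra_simps)
      qed simp
      \<comment> \<open>\<open>s + 2\<close> is bounded by \<open>3 * s\<close> in the positive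
        term, using \<open>s \<ge> 1\<close>, and from below by \<open>s\<close> in the subtracted
        one.\<close>
      also have "\<dots> \<le> 3 * (real s * u\<^sup>2) - D\<^sup>2 / 4 * real s"
      proof -
        have "u\<^sup>2 * (real s + 2) \<le> u\<^sup>2 * (3 * real s)" using s by (intro mult_left_mono) auto
        moreover have "D\<^sup>2 / 4 * real s \<le> D\<^sup>2 / 4 * (real s + 2)" by (intro mult_left_mono) auto
        moreover have "3 * (real s * u\<^sup>2) = u\<^sup>2 * (3 * real s)" by simp
        ultimately show ?thesis unfolding left_diff_distrib by linarith
      qed
      also have "real s * u\<^sup>2 = (?Z \<omega>)\<^sup>2"
        by (simp add: u_def power_mult_distrib power2_commute)
      finally have "3/8 * ((\<tau> - ?m \<omega>)\<^sup>2 * (real s + 2)) / \<sigma>\<^sup>2 \<le> 3/8 * (3 * (?Z \<omega>)\<^sup>2 - D\<^sup>2 / 4 * real s) / \<sigma>\<^sup>2"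
        by (intro divide_right_mono mult_left_mono) auto
      also have "\<dots> = ?a * (?Z \<omega>)\<^sup>2 + - (3 * D\<^sup>2 / (32 * \<sigma>\<^sup>2) * real s)"
        using sigma_pos by (simp add: field_simps)
      finally have "2 * sqrt 3 * exp (3/8 * (\<tau> - ?m \<omega>)\<^sup>2 * (real s + 2) / \<sigma>\<^sup>2) \<le>
          2 * sqrt 3 * exp (?a * (?Z \<omega>)\<^sup>2 + - (3 * D\<^sup>2 / (32 * \<sigma>\<^sup>2) * real s))"
        by (intro mult_left_mono) (auto simp: mult.assoc)
      also have "\<dots> = q * exp (?a * (?Z \<omega>)\<^sup>2)"
        unfolding exp_add by (simp add: q_def)
      finally have "1 / score_tail \<sigma> \<tau> s ?y - 1 \<le> q * exp (?a * (?Z \<omega>)\<^sup>2)"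
        using score_odds_below[OF sigma_pos, of s ?y \<tau>] False by linarith
      moreover have "0 \<le> (indicator ?bad \<omega> :: real)" by simp
      ultimately show ?thesis using nonneg by linarith
    qed
    then have "ennreal (1 / score_tail \<sigma> \<tau> s ?y - 1) \<le> ennreal (indicator ?bad \<omega> + (p + q * exp (?a * (?Z \<omega>)\<^sup>2)))"
      by (rule ennreal_leI)
    also have "\<dots> = indicator ?bad \<omega> + (ennreal p + ennreal q * ennreal (exp (?a * (?Z \<omega>)\<^sup>2)))"
      using nonneg by (simp add: ennreal_plus ennreal_mult ennreal_indicator)
    finally show "ennreal (1 / score_tail \<sigma> \<tau> s ?y - 1) \<le>
      indicator ?bad \<omega> + (ennreal p + ennreal q * ennreal (exp (?a * (?Z \<omega>)\<^sup>2)))" .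
  qed
  also have "\<dots> = emeasure M ?bad + (ennreal p + ennreal q * (\<integral>\<^sup>+\<omega>. ennreal (exp (?a * (?Z \<omega>)\<^sup>2)) \<partial>M))"
    by (simp add: nn_integral_add nn_integral_cmult emeasure_space_1)
  also have "(\<integral>\<^sup>+\<omega>. ennreal (exp (?a * (?Z \<omega>)\<^sup>2)) \<partial>M) = ennreal B"
    unfolding B[symmetric] by (rule nn_integral_exp_square_normal[OF Z a])
  also have "emeasure M ?bad + (ennreal p + ennreal q * ennreal B) \<le>
      ennreal ((1/2) ^ s + exp (- ((D/4)\<^sup>2 / 2 * real s))) + (ennreal p + ennreal q * ennreal B)"
    using D s by (intro add_right_mono emeasure_not_concentrated) auto
  also have "\<dots> = ennreal ((1/2) ^ s + exp (- (D\<^sup>2 / 32 * real s)) + p + q * B)"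
  proof -
    have "0 \<le> B" unfolding B_def using s2 by (simp add: divide_le_eq)
    then show ?thesis using nonneg
      by (simp add: power_divide add.assoc flip: ennreal_plus ennreal_mult)
  qed
  also have "(1/2) ^ s + exp (- (D\<^sup>2 / 32 * real s)) + p + q * B =
      (1/2) ^ s + exp (- (D\<^sup>2 / 32 * real s)) + exp (- (D\<^sup>2 / (128 * \<sigma>\<^sup>2) * real s)) +
      2 * sqrt 3 * B * exp (- (3 * D\<^sup>2 / (32 * \<sigma>\<^sup>2) * real s))"
    by (simp add: p_def q_def)
  finally show ?thesis .
qed

end

section \<open>Expected number of pulls of a suboptimal arm\<close>

context gaussian_reboot
begin

lemma arm_eq_argmax: "K \<le> n \<Longrightarrow> arm n \<omega> = argmax_arm K (\<lambda>k. index n k \<omega>)"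
  unfolding arm_def index_def hist_def
  by (simp add: pulled_arm_argmax reboot_idx_eq_score[abs_def])

text \<open>The Thompson sampling comparison. Given everything but the weights of arm 1, a suboptimal
  arm can only win below \<open>\<tau>\<close> if all competitors of arm 1 are below \<open>\<tau>\<close>; on that event arm 1
  wins with probability at least \<open>score_tail\<close>.\<close>

lemma nn_integral_arm_below_le:
  assumes n: "K \<le> n" and k: "k \<in> {2..K}"
  shows "(\<integral>\<^sup>+\<omega>. indicator {\<omega>. arm n \<omega> = k \<and> index n k \<omega> < \<tau>} \<omega> \<partial>M) \<le>
    (\<integral>\<^sup>+\<omega>. (if arm n \<omega> = 1
      then ennreal (1 / score_tail \<sigma> \<tau> (pulls (hist n \<omega>) 1) (\<lambda>j. X 1 j \<omega>) - 1) else 0) \<partial>M)"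
proof -
  let ?x = "\<lambda>\<omega> d. (case d of Inl (k, j) \<Rightarrow> X k j | Inr (n, k, i) \<Rightarrow> W n k i) \<omega>"
  let ?P = "(\<Pi>\<^sub>M i\<in>UNIV. borel) :: (draw \<Rightarrow> real) measure"
  define h where "h x = reboot_hist K \<sigma> (\<lambda>k j. x (Inl (k, j))) (\<lambda>n k i. x (Inr (n, k, i))) n"
    for x :: "draw \<Rightarrow> real"
  define idx where "idx j x = score \<sigma> (pulls (h x) j) (\<lambda>i. x (Inl (j, i))) (\<lambda>i. x (Inr (n, j, i)))"
    for j and x :: "draw \<Rightarrow> real"
  define tail where "tail x = score_tail \<sigma> \<tau> (pulls (h x) 1) (\<lambda>j. x (Inl (1, j)))" for x :: "draw \<Rightarrow> real"
  define tail' where "tail' \<omega> = score_tail \<sigma> \<tau> (pulls (hist n \<omega>) 1) (\<lambda>j. X 1 j \<omega>)" for \<omega>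
  \<comment> \<open>All competitors of arm 1 are below \<open>\<tau>\<close>. Arm 1 is left out so
    that \<open>g\<close> is invariant under redrawing its weights in round
    \<open>n\<close>.\<close>
  define g :: "(draw \<Rightarrow> real) \<Rightarrow> ennreal" where "g x = (if \<forall>j\<in>{2..K}. idx j x < \<tau> then 1 else 0)" for x
  have coord: "(\<lambda>x. x d) \<in> borel_measurable ?P" for d
    by (rule measurable_component_singleton) simp
  have pulls_h: "(\<lambda>x. pulls (h x) j) \<in> ?P \<rightarrow>\<^sub>M count_space UNIV" for j
    unfolding h_def by (rule measurable_pulls_reboot_hist) (rule coord)+
  have [measurable]: "idx j \<in> borel_measurable ?P" for j
    unfolding idx_def by (rule measurable_compose_countable[OF _ pulls_h]) (intro borel_measurable_score coord)
  have [measurable]: "tail \<in> borel_measurable ?P"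
    unfolding tail_def by (rule measurable_compose_countable[OF _ pulls_h]) (intro borel_measurable_score_tail coord)
  have g_measurable [measurable]: "g \<in> borel_measurable ?P"
    unfolding g_def by measurable
  have h_cong: "h x = h x'" if "\<forall>d. (\<forall>i. d \<noteq> Inr (n, 1, i)) \<longrightarrow> x d = x' d" for x x'
  proof -
    have "(\<lambda>k j. x (Inl (k, j))) = (\<lambda>k j. x' (Inl (k, j)))" using that by auto
    then show ?thesis unfolding h_def using that by (auto intro!: reboot_hist_cong)
  qed
  have tail_cong: "tail x = tail x'" if "\<forall>d. (\<forall>i. d \<noteq> Inr (n, 1, i)) \<longrightarrow> x d = x' d" for x x'
    unfolding tail_def h_cong[OF that] using that by simp
  have g_cong: "g x = g x'" if eq: "\<forall>d. (\<forall>i. d \<noteq> Inr (n, 1, i)) \<longrightarrow> x d = x' d" for x x'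
  proof -
    have "idx j x = idx j x'" if "j \<in> {2..K}" for j
    proof -
      have "(\<lambda>i. x (Inl (j, i))) = (\<lambda>i. x' (Inl (j, i)))" "(\<lambda>i. x (Inr (n, j, i))) = (\<lambda>i. x' (Inr (n, j, i)))"
        using \<open>j \<in> _\<close> eq by auto
      then show ?thesis
        unfolding idx_def h_cong[OF eq] by simp
    qed
    then show ?thesis by (simp add: g_def)
  qed
  have idx_eq: "idx j (?x \<omega>) = index n j \<omega>" for j \<omega>
    by (simp add: idx_def h_def index_def hist_def)
  have tail_eq: "tail (?x \<omega>) = tail' \<omega>" for \<omega>
    by (simp add: tail_def h_def tail'_def hist_def)
  have g_eq: "g (?x \<omega>) = (if \<forall>j\<in>{2..K}. index n j \<omega> < \<tau> then 1 else 0)" for \<omega>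
    unfolding g_def idx_eq ..
  have tail': "0 < tail' \<omega>" "tail' \<omega> \<le> 1" for \<omega>
    by (simp_all add: tail'_def score_tail_pos score_tail_le_1)
  have K: "1 \<le> K" using k by auto
  have "(\<integral>\<^sup>+\<omega>. indicator {\<omega>. arm n \<omega> = k \<and> index n k \<omega> < \<tau>} \<omega> \<partial>M) \<le>
      (\<integral>\<^sup>+\<omega>. g (?x \<omega>) * indicator {\<omega>. index n 1 \<omega> < \<tau>} \<omega> \<partial>M)"
  proof (intro nn_integral_mono)
    fix \<omega>
    have "index n j \<omega> < \<tau>" if "arm n \<omega> = k" "index n k \<omega> < \<tau>" "j \<in> {1..K}" for j
      using argmax_arm_is_max[OF K, of "\<lambda>k. index n k \<omega>"] that arm_eq_argmax[OF n, of \<omega>] by force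
    then show "indicator {\<omega>. arm n \<omega> = k \<and> index n k \<omega> < \<tau>} \<omega> \<le> g (?x \<omega>) * indicator {\<omega>. index n 1 \<omega> < \<tau>} \<omega>"
      unfolding g_eq using K by (auto simp: indicator_def)
  qed
  also have "\<dots> = (\<integral>\<^sup>+\<omega>. g (?x \<omega>) * ennreal (1 - tail' \<omega>) \<partial>M)"
    unfolding tail'_def by (rule nn_integral_index(2)[OF g_measurable g_cong])
  \<comment> \<open>Writing \<open>1 - Q\<close> as \<open>(1 / Q - 1) * Q\<close> turns the failure
    of arm 1 into its success at the price of the odds; the factor \<open>Q\<close> is then read
    back as the event that its index reaches \<open>\<tau>\<close>.\<close>
  also have "\<dots> = (\<integral>\<^sup>+\<omega>. (g (?x \<omega>) * ennreal (1 / tail (?x \<omega>) - 1)) * ennreal (tail' \<omega>) \<partial>M)"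
  proof (intro nn_integral_cong)
    fix \<omega>
    have "(1 / tail' \<omega> - 1) * tail' \<omega> = 1 - tail' \<omega>" "0 \<le> 1 / tail' \<omega> - 1"
      using tail'[of \<omega>] by (auto simp: field_simps)
    then show "g (?x \<omega>) * ennreal (1 - tail' \<omega>) = (g (?x \<omega>) * ennreal (1 / tail (?x \<omega>) - 1)) * ennreal (tail' \<omega>)"
      using tail'[of \<omega>] unfolding tail_eq mult.assoc by (simp add: less_imp_le flip: ennreal_mult)
  qed
  also have "\<dots> = (\<integral>\<^sup>+\<omega>. (g (?x \<omega>) * ennreal (1 / tail (?x \<omega>) - 1)) * indicator {\<omega>. \<tau> \<le> index n 1 \<omega>} \<omega> \<partial>M)"
    unfolding tail'_def
  proof (rule nn_integral_index(1)[symmetric, where g="\<lambda>x. g x * ennreal (1 / tail x - 1)"])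
    show "g x * ennreal (1 / tail x - 1) = g x' * ennreal (1 / tail x' - 1)"
      if "\<forall>d. (\<forall>i. d \<noteq> Inr (n, 1, i)) \<longrightarrow> x d = x' d" for x x'
      unfolding g_cong[OF that] tail_cong[OF that] ..
  qed measurable
  also have "\<dots> \<le> (\<integral>\<^sup>+\<omega>. (if arm n \<omega> = 1 then ennreal (1 / tail' \<omega> - 1) else 0) \<partial>M)"
  proof (intro nn_integral_mono)
    fix \<omega>
    \<comment> \<open>Arm 1 is then strictly ahead of every other arm, so it is the unique
      maximiser.\<close>
    have "arm n \<omega> = 1" if "\<forall>j\<in>{2..K}. index n j \<omega> < \<tau>" "\<tau> \<le> index n 1 \<omega>"
    proof -
      have "index n j \<omega> < index n 1 \<omega>" if "j \<in> {1..K}" "j \<noteq> 1" for j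
      proof -
        have "j \<in> {2..K}" using that by auto
        then show ?thesis using \<open>\<forall>j\<in>{2..K}. _\<close> \<open>\<tau> \<le> _\<close> by force
      qed
      then show ?thesis
        unfolding arm_eq_argmax[OF n] using K by (intro argmax_arm_unique) auto
    qed
    then show "(g (?x \<omega>) * ennreal (1 / tail (?x \<omega>) - 1)) * indicator {\<omega>. \<tau> \<le> index n 1 \<omega>} \<omega> \<le>
        (if arm n \<omega> = 1 then ennreal (1 / tail' \<omega> - 1) else 0)"
      unfolding g_eq tail_eq by (auto simp: indicator_def)
  qed
  finally show ?thesis unfolding tail'_def .
qed

text \<open>\<open>G\<close> looks only at the pull count and the rewards of arm \<open>k\<close>,
  hence survives redrawing the weights of that arm in round \<open>n\<close>. Conditionally, the
  index then reaches \<open>\<tau>\<close> with probability at most \<open>c\<close>.\<close>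

lemma nn_integral_index_ge_le:
  assumes G: "\<And>s. Measurable.pred (\<Pi>\<^sub>M i\<in>UNIV. borel) (G s)"
    and le: "\<And>s y. G s y \<Longrightarrow> score_tail \<sigma> \<tau> s y \<le> c"
  shows "(\<integral>\<^sup>+\<omega>. indicator {\<omega>. G (pulls (hist n \<omega>) k) (\<lambda>j. X k j \<omega>) \<and> \<tau> \<le> index n k \<omega>} \<omega> \<partial>M) \<le> ennreal c"
proof -
  let ?x = "\<lambda>\<omega> d. (case d of Inl (k, j) \<Rightarrow> X k j | Inr (n, k, i) \<Rightarrow> W n k i) \<omega>"
  let ?P = "(\<Pi>\<^sub>M i\<in>UNIV. borel) :: (draw \<Rightarrow> real) measure"
  define h where "h x = reboot_hist K \<sigma> (\<lambda>k j. x (Inl (k, j))) (\<lambda>n k i. x (Inr (n, k, i))) n"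
    for x :: "draw \<Rightarrow> real"
  define g :: "(draw \<Rightarrow> real) \<Rightarrow> ennreal" where
    "g x = (if G (pulls (h x) k) (\<lambda>j. x (Inl (k, j))) then 1 else 0)" for x
  have coord: "(\<lambda>x. x d) \<in> borel_measurable ?P" for d
    by (rule measurable_component_singleton) simp
  have pulls_h: "(\<lambda>x. pulls (h x) j) \<in> ?P \<rightarrow>\<^sub>M count_space UNIV" for j
    unfolding h_def by (rule measurable_pulls_reboot_hist) (rule coord)+
  have stack: "(\<lambda>x j. x (Inl (k, j))) \<in> ?P \<rightarrow>\<^sub>M (\<Pi>\<^sub>M i\<in>UNIV. borel)"
    by (rule measurable_PiM_single') (auto intro: coord)
  have [measurable]: "Measurable.pred ?P (\<lambda>x. G (pulls (h x) k) (\<lambda>j. x (Inl (k, j))))"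
    by (rule measurable_compose_countable[OF _ pulls_h]) (rule measurable_compose[OF stack G])
  have g_measurable: "g \<in> borel_measurable ?P"
    unfolding g_def by measurable
  have g_cong: "g x = g x'" if "\<forall>d. (\<forall>i. d \<noteq> Inr (n, k, i)) \<longrightarrow> x d = x' d" for x x'
  proof -
    have "(\<lambda>k j. x (Inl (k, j))) = (\<lambda>k j. x' (Inl (k, j)))" using that by auto
    moreover from this have "h x = h x'" unfolding h_def using that by (auto intro!: reboot_hist_cong)
    ultimately show ?thesis unfolding g_def by (metis (no_types, lifting))
  qed
  have g_eq: "g (?x \<omega>) = (if G (pulls (hist n \<omega>) k) (\<lambda>j. X k j \<omega>) then 1 else 0)" for \<omega>
    by (simp add: g_def h_def hist_def)
  have "(\<integral>\<^sup>+\<omega>. indicator {\<omega>. G (pulls (hist n \<omega>) k) (\<lambda>j. X k j \<omega>) \<and> \<tau> \<le> index n k \<omega>} \<omega> \<partial>M) =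
      (\<integral>\<^sup>+\<omega>. g (?x \<omega>) * indicator {\<omega>. \<tau> \<le> index n k \<omega>} \<omega> \<partial>M)"
    unfolding g_eq by (intro nn_integral_cong) (auto simp: indicator_def)
  also have "\<dots> = (\<integral>\<^sup>+\<omega>. g (?x \<omega>) * ennreal (score_tail \<sigma> \<tau> (pulls (hist n \<omega>) k) (\<lambda>j. X k j \<omega>)) \<partial>M)"
    by (rule nn_integral_index(1)[OF g_measurable g_cong])
  also have "\<dots> \<le> (\<integral>\<^sup>+\<omega>. ennreal c \<partial>M)"
    unfolding g_eq by (intro nn_integral_mono) (auto intro: ennreal_leI le)
  finally show ?thesis by (simp add: emeasure_space_1)
qed

text \<open>Pulls of \<open>k\<close> below \<open>\<tau>\<close> are paid for by pulls of arm 1.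
  Each sample size of arm 1 pays at most once, and four geometric series bound the total
  independently of the horizon.\<close>

lemma sum_nn_integral_arm_below_le:
  assumes k: "k \<in> {2..K}" and D: "0 < D" and \<tau>: "\<tau> = \<mu> 1 - D / 2"
  defines "B \<equiv> 1 / sqrt (1 - 9/4 / \<sigma>\<^sup>2)"
  shows "(\<Sum>n\<in>{K..<T}. \<integral>\<^sup>+\<omega>. indicator {\<omega>. arm n \<omega> = k \<and> index n k \<omega> < \<tau>} \<omega> \<partial>M) \<le>
    ennreal (1 + 32 / D\<^sup>2 + 128 * \<sigma>\<^sup>2 / D\<^sup>2 + 2 * sqrt 3 * B * (32 * \<sigma>\<^sup>2 / (3 * D\<^sup>2)))"
proof -
  let ?odds = "\<lambda>s \<omega>. ennreal (1 / score_tail \<sigma> \<tau> s (\<lambda>j. X 1 j \<omega>) - 1)"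
  have B: "0 \<le> B"
    using power_strict_mono[of "3/2" \<sigma> 2] sigma_gt by (simp add: B_def divide_le_eq power2_eq_square)
  have "(\<Sum>n\<in>{K..<T}. \<integral>\<^sup>+\<omega>. indicator {\<omega>. arm n \<omega> = k \<and> index n k \<omega> < \<tau>} \<omega> \<partial>M) \<le>
      (\<Sum>n\<in>{K..<T}. \<integral>\<^sup>+\<omega>. (if arm n \<omega> = 1 then ?odds (pulls (hist n \<omega>) 1) \<omega> else 0) \<partial>M)"
    using k by (intro sum_mono nn_integral_arm_below_le) auto
  also have "\<dots> = (\<integral>\<^sup>+\<omega>. (\<Sum>n\<in>{K..<T}. if arm n \<omega> = 1 then ?odds (pulls (hist n \<omega>) 1) \<omega> else 0) \<partial>M)"
    by (rule nn_integral_sum[symmetric]) measurable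
  also have "\<dots> \<le> (\<integral>\<^sup>+\<omega>. (\<Sum>s\<in>{1..<T}. ?odds s \<omega>) \<partial>M)"
    unfolding arm_def hist_def using k by (intro nn_integral_mono sum_over_late_pulls_le) auto
  also have "\<dots> = (\<Sum>s\<in>{1..<T}. \<integral>\<^sup>+\<omega>. ?odds s \<omega> \<partial>M)"
    by (rule nn_integral_sum) measurable
  also have "\<dots> \<le> (\<Sum>s\<in>{1..<T}. ennreal ((1/2) ^ s + exp (- (D\<^sup>2 / 32 * real s)) +
      exp (- (D\<^sup>2 / (128 * \<sigma>\<^sup>2) * real s)) + 2 * sqrt 3 * B * exp (- (3 * D\<^sup>2 / (32 * \<sigma>\<^sup>2) * real s))))"
    unfolding B_def using D \<tau> by (intro sum_mono nn_integral_score_odds_le) auto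
  also have "\<dots> = ennreal ((\<Sum>s\<in>{1..<T}. (1/2) ^ s) + (\<Sum>s\<in>{1..<T}. exp (- (D\<^sup>2 / 32 * real s))) +
      (\<Sum>s\<in>{1..<T}. exp (- (D\<^sup>2 / (128 * \<sigma>\<^sup>2) * real s))) +
      2 * sqrt 3 * B * (\<Sum>s\<in>{1..<T}. exp (- (3 * D\<^sup>2 / (32 * \<sigma>\<^sup>2) * real s))))"
    using B by (subst sum_ennreal) (auto simp: sum.distrib sum_distrib_left)
  also have "\<dots> \<le> ennreal (1 + 1 / (D\<^sup>2 / 32) + 1 / (D\<^sup>2 / (128 * \<sigma>\<^sup>2)) +
      2 * sqrt 3 * B * (1 / (3 * D\<^sup>2 / (32 * \<sigma>\<^sup>2))))"
    using B D sigma_pos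
    by (intro ennreal_leI add_mono mult_left_mono sum_half_powers_le sum_exp_geometric_le) auto
  finally show ?thesis by simp
qed

text \<open>Rounds where \<open>G\<close> holds cost at most \<open>1 / T\<close> each, hence at
  most 1 altogether. Where \<open>G\<close> fails, the pulls of \<open>k\<close> are counted by
  sample size: at most \<open>c\<close> sizes are too small, and the failures of concentration are
  summable.\<close>

lemma sum_nn_integral_arm_above_le:
  assumes k: "k \<in> {2..K}" and D: "0 < D" and \<tau>: "\<tau> = \<mu> k + D / 2" and T: "1 \<le> T"
  shows "(\<Sum>n\<in>{K..<T}. \<integral>\<^sup>+\<omega>. indicator {\<omega>. arm n \<omega> = k \<and> \<tau> \<le> index n k \<omega>} \<omega> \<partial>M) \<le>
    ennreal (2 + 32 / D\<^sup>2 + 128 * \<sigma>\<^sup>2 * ln (real T) / D\<^sup>2)"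
proof -
  \<comment> \<open>From this sample size on, the exponent
    \<open>D\<^sup>2 * s / (128 * \<sigma>\<^sup>2)\<close> is at least \<open>ln T\<close>.\<close>
  define c where "c = 128 * \<sigma>\<^sup>2 * ln (real T) / D\<^sup>2"
  have c: "0 \<le> c" using T by (simp add: c_def)
  define G where "G s y \<longleftrightarrow> c \<le> real s \<and> concentrated \<sigma> (\<mu> k) (D/4) s y" for s y
  have G_meas: "Measurable.pred (\<Pi>\<^sub>M i\<in>UNIV. borel) (G s)" for s
    unfolding G_def by measurable
  have G_M [measurable]: "Measurable.pred M (\<lambda>\<omega>. G s (\<lambda>j. X k j \<omega>))" for s
    unfolding G_def by measurable
  have [measurable]: "Measurable.pred M (\<lambda>\<omega>. G (pulls (hist n \<omega>) k) (\<lambda>j. X k j \<omega>))" for n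
    by (rule measurable_compose_countable[OF G_M pulls_hist_measurable])
  have G_tail: "score_tail \<sigma> \<tau> s y \<le> 1 / real T" if "G s y" for s y
  proof -
    have "\<bar>sample_mean s y - \<mu> k\<bar> \<le> D / 4" using that by (simp add: G_def concentrated_def)
    then have "D / 4 \<le> \<tau> - sample_mean s y" using \<tau> by linarith
    then have "score_tail \<sigma> \<tau> s y \<le> exp (- ((D/4)\<^sup>2 * (real s + 2) / (8 * \<sigma>\<^sup>2)))"
      using that D by (intro score_tail_le[where c="\<mu> k"] sigma_pos) (auto simp: G_def concentrated_def)
    also have "\<dots> \<le> exp (- ln (real T))"
    proof -
      have "128 * \<sigma>\<^sup>2 * ln (real T) \<le> real s * D\<^sup>2"
        using that D by (simp add: G_def c_def divide_le_eq)
      also have "\<dots> \<le> (real s + 2) * D\<^sup>2" by (intro mult_right_mono) auto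
      finally show ?thesis using sigma_pos by (simp add: power_divide le_divide_eq mult_ac)
    qed
    also have "\<dots> = 1 / real T" using T by (simp add: exp_minus inverse_eq_divide)
    finally show ?thesis .
  qed
  have "(\<Sum>n\<in>{K..<T}. \<integral>\<^sup>+\<omega>. indicator {\<omega>. arm n \<omega> = k \<and> \<tau> \<le> index n k \<omega>} \<omega> \<partial>M) \<le>
      (\<Sum>n\<in>{K..<T}. (\<integral>\<^sup>+\<omega>. (if arm n \<omega> = k then indicator {s. \<not> G s (\<lambda>j. X k j \<omega>)} (pulls (hist n \<omega>) k) else 0) \<partial>M) +
        (\<integral>\<^sup>+\<omega>. indicator {\<omega>. G (pulls (hist n \<omega>) k) (\<lambda>j. X k j \<omega>) \<and> \<tau> \<le> index n k \<omega>} \<omega> \<partial>M))"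
  proof (intro sum_mono)
    fix n
    have "(\<integral>\<^sup>+\<omega>. indicator {\<omega>. arm n \<omega> = k \<and> \<tau> \<le> index n k \<omega>} \<omega> \<partial>M) \<le>
      (\<integral>\<^sup>+\<omega>. (if arm n \<omega> = k then indicator {s. \<not> G s (\<lambda>j. X k j \<omega>)} (pulls (hist n \<omega>) k) else 0) +
        indicator {\<omega>. G (pulls (hist n \<omega>) k) (\<lambda>j. X k j \<omega>) \<and> \<tau> \<le> index n k \<omega>} \<omega> \<partial>M)"
      by (intro nn_integral_mono) (auto simp: indicator_def)
    also have "\<dots> = (\<integral>\<^sup>+\<omega>. (if arm n \<omega> = k then indicator {s. \<not> G s (\<lambda>j. X k j \<omega>)} (pulls (hist n \<omega>) k) else 0) \<partial>M) +
        (\<integral>\<^sup>+\<omega>. indicator {\<omega>. G (pulls (hist n \<omega>) k) (\<lambda>j. X k j \<omega>) \<and> \<tau> \<le> index n k \<omega>} \<omega> \<partial>M)"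
      by (rule nn_integral_add) (simp_all add: indicator_def)
    finally show "(\<integral>\<^sup>+\<omega>. indicator {\<omega>. arm n \<omega> = k \<and> \<tau> \<le> index n k \<omega>} \<omega> \<partial>M) \<le> \<dots>" .
  qed
  also have "\<dots> = (\<Sum>n\<in>{K..<T}. \<integral>\<^sup>+\<omega>. (if arm n \<omega> = k then indicator {s. \<not> G s (\<lambda>j. X k j \<omega>)} (pulls (hist n \<omega>) k) else 0) \<partial>M) +
      (\<Sum>n\<in>{K..<T}. \<integral>\<^sup>+\<omega>. indicator {\<omega>. G (pulls (hist n \<omega>) k) (\<lambda>j. X k j \<omega>) \<and> \<tau> \<le> index n k \<omega>} \<omega> \<partial>M)"
    by (rule sum.distrib)
  also have "\<dots> \<le> ennreal (1 + 32 / D\<^sup>2 + c) + ennreal 1"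
  proof (intro add_mono)
    have "(\<Sum>n\<in>{K..<T}. \<integral>\<^sup>+\<omega>. indicator {\<omega>. G (pulls (hist n \<omega>) k) (\<lambda>j. X k j \<omega>) \<and> \<tau> \<le> index n k \<omega>} \<omega> \<partial>M) \<le>
        (\<Sum>n\<in>{K..<T}. ennreal (1 / real T))"
      by (intro sum_mono nn_integral_index_ge_le G_meas G_tail)
    also have "\<dots> = ennreal (\<Sum>n\<in>{K..<T}. 1 / real T)"
      by (rule sum_ennreal) simp
    also have "\<dots> \<le> ennreal 1"
      using T by (intro ennreal_leI) (simp add: divide_le_eq)
    finally show "(\<Sum>n\<in>{K..<T}. \<integral>\<^sup>+\<omega>. indicator {\<omega>. G (pulls (hist n \<omega>) k) (\<lambda>j. X k j \<omega>) \<and>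
        \<tau> \<le> index n k \<omega>} \<omega> \<partial>M) \<le> ennreal 1" .
  next
    have "(\<Sum>n\<in>{K..<T}. \<integral>\<^sup>+\<omega>. (if arm n \<omega> = k then indicator {s. \<not> G s (\<lambda>j. X k j \<omega>)} (pulls (hist n \<omega>) k) else 0) \<partial>M) =
        (\<integral>\<^sup>+\<omega>. (\<Sum>n\<in>{K..<T}. if arm n \<omega> = k then indicator {s. \<not> G s (\<lambda>j. X k j \<omega>)} (pulls (hist n \<omega>) k) else 0) \<partial>M)"
      by (rule nn_integral_sum[symmetric]) (simp add: indicator_def)
    also have "\<dots> \<le> (\<integral>\<^sup>+\<omega>. (\<Sum>s\<in>{1..<T}. indicator {s. \<not> G s (\<lambda>j. X k j \<omega>)} s) \<partial>M)"
      unfolding arm_def hist_def using k by (intro nn_integral_mono sum_over_late_pulls_le) auto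
    also have "\<dots> = (\<Sum>s\<in>{1..<T}. \<integral>\<^sup>+\<omega>. indicator {s. \<not> G s (\<lambda>j. X k j \<omega>)} s \<partial>M)"
      by (rule nn_integral_sum) (simp add: indicator_def)
    also have "\<dots> \<le> (\<Sum>s\<in>{1..<T}. ennreal ((if real s < c then 1 else 0) + ((1/2) ^ s + exp (- ((D/4)\<^sup>2 / 2 * real s)))))"
    proof (intro sum_mono)
      fix s assume s: "s \<in> {1..<T}"
      let ?bad = "{\<omega> \<in> space M. \<not> concentrated \<sigma> (\<mu> k) (D/4) s (\<lambda>j. X k j \<omega>)}"
      have "(\<integral>\<^sup>+\<omega>. indicator {s. \<not> G s (\<lambda>j. X k j \<omega>)} s \<partial>M) \<le>
          (\<integral>\<^sup>+\<omega>. ennreal (if real s < c then 1 else 0) + indicator ?bad \<omega> \<partial>M)"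
        by (intro nn_integral_mono) (auto simp: indicator_def G_def)
      also have "\<dots> = ennreal (if real s < c then 1 else 0) + emeasure M ?bad"
        by (subst nn_integral_add) (auto simp: emeasure_space_1)
      also have "\<dots> \<le> ennreal (if real s < c then 1 else 0) + ennreal ((1/2) ^ s + exp (- ((D/4)\<^sup>2 / 2 * real s)))"
        using D s by (intro add_left_mono emeasure_not_concentrated) auto
      also have "\<dots> = ennreal ((if real s < c then 1 else 0) + ((1/2) ^ s + exp (- ((D/4)\<^sup>2 / 2 * real s))))"
        by (rule ennreal_plus[symmetric]) auto
      finally show "(\<integral>\<^sup>+\<omega>. indicator {s. \<not> G s (\<lambda>j. X k j \<omega>)} s \<partial>M) \<le> \<dots>" .
    qed
    also have "\<dots> = ennreal ((\<Sum>s\<in>{1..<T}. if real s < c then 1 else 0) +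
        ((\<Sum>s\<in>{1..<T}. (1/2) ^ s) + (\<Sum>s\<in>{1..<T}. exp (- ((D/4)\<^sup>2 / 2 * real s)))))"
      by (subst sum_ennreal) (auto simp: sum.distrib)
    also have "\<dots> \<le> ennreal (c + (1 + 1 / ((D/4)\<^sup>2 / 2)))"
    proof (intro ennreal_leI add_mono sum_half_powers_le sum_exp_geometric_le)
      \<comment> \<open>Since \<open>s\<close> starts at 1, the sizes below \<open>c\<close> number
        at most the floor of \<open>c\<close>, without an additional 1.\<close>
      have "(\<Sum>s\<in>{1..<T}. if real s < c then 1 else 0 :: real) = real (card {s \<in> {1..<T}. real s < c})"
        by (simp flip: sum.inter_filter)
      also have "\<dots> \<le> real (card {1..nat \<lfloor>c\<rfloor>})"
        by (intro of_nat_mono card_mono) (auto simp: le_nat_floor)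
      also have "\<dots> \<le> c" using c by simp
      finally show "(\<Sum>s\<in>{1..<T}. if real s < c then 1 else 0) \<le> c" .
    qed (use D in auto)
    also have "c + (1 + 1 / ((D/4)\<^sup>2 / 2)) = 1 + 32 / D\<^sup>2 + c"
      by (simp add: power_divide)
    finally show "(\<Sum>n\<in>{K..<T}. \<integral>\<^sup>+\<omega>. (if arm n \<omega> = k then indicator {s. \<not> G s (\<lambda>j. X k j \<omega>)} (pulls (hist n \<omega>) k) else 0) \<partial>M)
        \<le> ennreal (1 + 32 / D\<^sup>2 + c)" .
  qed
  also have "\<dots> = ennreal (1 + 32 / D\<^sup>2 + c + 1)"
    using c by (intro ennreal_plus[symmetric]) auto
  finally show ?thesis by (simp add: c_def add.assoc)
qed

text \<open>One initial pull plus the pulls below and above the midpoint of the two means. What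
  remains is to fit the explicit constants into \<open>reboot_C2 \<sigma> * ln T\<close>.\<close>

lemma expected_pulls_le:
  assumes k: "k \<in> {2..K}" and gap: "\<mu> k < \<mu> 1" and T: "2 \<le> T"
  shows "expectation (\<lambda>\<omega>. real (pulls (hist T \<omega>) k)) \<le>
    6 + (reboot_C1 \<sigma> + reboot_C2 \<sigma> / (\<mu> 1 - \<mu> k)\<^sup>2) * ln (real T)"
proof -
  define D where "D = \<mu> 1 - \<mu> k"
  define \<tau> where "\<tau> = \<mu> 1 - D / 2"
  define B where "B = 1 / sqrt (1 - 9/4 / \<sigma>\<^sup>2)"
  define L where "L = ln (real T)"
  have D: "0 < D" using gap by (simp add: D_def)
  have \<tau>': "\<tau> = \<mu> k + D / 2" by (simp add: \<tau>_def D_def field_simps)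
  have s2: "9/4 < \<sigma>\<^sup>2" using power_strict_mono[of "3/2" \<sigma> 2] sigma_gt by (simp add: power2_eq_square)
  have B: "0 \<le> B" using s2 by (simp add: B_def divide_le_eq)
  have "ln 2 \<le> L"
    unfolding L_def using T by (subst ln_le_cancel_iff) auto
  \<comment> \<open>This turns terms without a logarithm into multiples of \<open>L\<close>.\<close>
  then have L: "2/3 \<le> L"
    using ln2_ge_two_thirds by linarith
  define E1 where "E1 = 1 + 32 / D\<^sup>2 + 128 * \<sigma>\<^sup>2 / D\<^sup>2 + 2 * sqrt 3 * B * (32 * \<sigma>\<^sup>2 / (3 * D\<^sup>2))"
  define E2 where "E2 = 2 + 32 / D\<^sup>2 + 128 * \<sigma>\<^sup>2 * L / D\<^sup>2"
  have E: "0 \<le> E1" "0 \<le> E2" using B L by (auto simp: E1_def E2_def)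
  have "(\<integral>\<^sup>+\<omega>. ennreal (real (pulls (hist T \<omega>) k)) \<partial>M) \<le>
      (\<integral>\<^sup>+\<omega>. 1 + ((\<Sum>n\<in>{K..<T}. indicator {\<omega>. arm n \<omega> = k \<and> index n k \<omega> < \<tau>} \<omega>) +
        (\<Sum>n\<in>{K..<T}. indicator {\<omega>. arm n \<omega> = k \<and> \<tau> \<le> index n k \<omega>} \<omega>)) \<partial>M)"
  proof (intro nn_integral_mono)
    fix \<omega>
    have "ennreal (real (pulls (hist T \<omega>) k)) \<le> ennreal (1 + (\<Sum>n\<in>{K..<T}. if arm n \<omega> = k then 1 else 0))"
      unfolding hist_def arm_def by (intro ennreal_leI pulls_reboot_hist_le_sum)
    also have "\<dots> = 1 + (\<Sum>n\<in>{K..<T}. ennreal (if arm n \<omega> = k then 1 else 0))"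
      by (subst ennreal_plus) (auto intro: sum_nonneg simp: sum_ennreal)
    also have "(\<Sum>n\<in>{K..<T}. ennreal (if arm n \<omega> = k then 1 else 0)) =
        (\<Sum>n\<in>{K..<T}. indicator {\<omega>. arm n \<omega> = k \<and> index n k \<omega> < \<tau>} \<omega> + indicator {\<omega>. arm n \<omega> = k \<and> \<tau> \<le> index n k \<omega>} \<omega>)"
      by (intro sum.cong) (auto simp: indicator_def)
    finally show "ennreal (real (pulls (hist T \<omega>) k)) \<le> 1 + ((\<Sum>n\<in>{K..<T}. indicator {\<omega>. arm n \<omega> = k \<and> index n k \<omega> < \<tau>} \<omega>) +
        (\<Sum>n\<in>{K..<T}. indicator {\<omega>. arm n \<omega> = k \<and> \<tau> \<le> index n k \<omega>} \<omega>))"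
      by (simp add: sum.distrib)
  qed
  also have "\<dots> = 1 + ((\<Sum>n\<in>{K..<T}. \<integral>\<^sup>+\<omega>. indicator {\<omega>. arm n \<omega> = k \<and> index n k \<omega> < \<tau>} \<omega> \<partial>M) +
      (\<Sum>n\<in>{K..<T}. \<integral>\<^sup>+\<omega>. indicator {\<omega>. arm n \<omega> = k \<and> \<tau> \<le> index n k \<omega>} \<omega> \<partial>M))"
    by (simp add: nn_integral_add nn_integral_sum emeasure_space_1)
  also have "\<dots> \<le> ennreal 1 + (ennreal E1 + ennreal E2)"
    unfolding E1_def E2_def B_def L_def using k D T
    by (intro add_mono sum_nn_integral_arm_below_le sum_nn_integral_arm_above_le \<tau>_def \<tau>') auto
  also have "\<dots> = ennreal (1 + (E1 + E2))"
    using E by (simp add: ennreal_plus)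
  finally have "expectation (\<lambda>\<omega>. real (pulls (hist T \<omega>) k)) \<le> 1 + (E1 + E2)"
    using E by (intro integral_real_bounded) auto
  also have "\<dots> = 4 + (64 + 128 * \<sigma>\<^sup>2 + 64 / 3 * (sqrt 3 * B * \<sigma>\<^sup>2) + 128 * \<sigma>\<^sup>2 * L) / D\<^sup>2"
    by (simp add: E1_def E2_def add_divide_distrib algebra_simps)
  also have "\<dots> \<le> 6 + reboot_C2 \<sigma> / D\<^sup>2 * L"
  proof -
    have "sqrt 3 \<le> 2" by (rule real_le_lsqrt) auto
    then have "64 / 3 * (sqrt 3 * B * \<sigma>\<^sup>2) \<le> 64 / 3 * (2 * B * \<sigma>\<^sup>2)"
      using B by (intro mult_left_mono mult_right_mono) auto
    moreover have "(\<sigma>\<^sup>2 * B) * (2/3) \<le> (\<sigma>\<^sup>2 * B) * L" "\<sigma>\<^sup>2 * (2/3) \<le> \<sigma>\<^sup>2 * L"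
      using B L by (intro mult_left_mono; simp)+
    moreover have "reboot_C2 \<sigma> * L = 128 * 3.1 * (\<sigma>\<^sup>2 * L) + 256 * (\<sigma>\<^sup>2 * B * L)"
      by (simp add: reboot_C2_def B_def algebra_simps)
    moreover have "64 / 3 * (2 * B * \<sigma>\<^sup>2) = 128 / 3 * (\<sigma>\<^sup>2 * B)" "128 * \<sigma>\<^sup>2 * L = 128 * (\<sigma>\<^sup>2 * L)" by simp_all
    moreover have "0 \<le> \<sigma>\<^sup>2 * B" using B by simp
    \<comment> \<open>By \<open>9/4 < \<sigma>\<^sup>2\<close> and \<open>2/3 \<le> L\<close>, the
      terms 64, \<open>128 * \<sigma>\<^sup>2\<close> and \<open>128 * \<sigma>\<^sup>2 * L\<close>
      together cost less than \<open>363 * \<sigma>\<^sup>2 * L\<close>, against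
      \<open>396.8 * \<sigma>\<^sup>2 * L\<close> available. The term with \<open>B\<close> costs at
      most 64 of the 256 multiples of \<open>\<sigma>\<^sup>2 * B * L\<close>.\<close>
    ultimately have "64 + 128 * \<sigma>\<^sup>2 + 64 / 3 * (sqrt 3 * B * \<sigma>\<^sup>2) + 128 * \<sigma>\<^sup>2 * L \<le> reboot_C2 \<sigma> * L"
      using s2 by linarith
    then have "(64 + 128 * \<sigma>\<^sup>2 + 64 / 3 * (sqrt 3 * B * \<sigma>\<^sup>2) + 128 * \<sigma>\<^sup>2 * L) / D\<^sup>2 \<le> reboot_C2 \<sigma> * L / D\<^sup>2"
      by (rule divide_right_mono) simp
    then show ?thesis by simp
  qed
  also have "\<dots> \<le> 6 + (reboot_C1 \<sigma> + reboot_C2 \<sigma> / D\<^sup>2) * L"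
    using s2 L by (simp add: reboot_C1_def distrib_right)
  finally show ?thesis unfolding D_def L_def .
qed

end

theorem theorem1:
  fixes M :: "'a measure" and K T :: nat and \<mu> :: "nat \<Rightarrow> real" and \<sigma>a :: real
    and X :: "nat \<Rightarrow> nat \<Rightarrow> 'a \<Rightarrow> real"
    and W :: "nat \<Rightarrow> nat \<Rightarrow> nat \<Rightarrow> 'a \<Rightarrow> real"
  assumes "prob_space M"
    and "2 \<le> K"
    and "\<forall>k\<in>{1..K}. \<mu> k \<le> \<mu> 1"
    and "\<sigma>a > 1.5"
    and "2 \<le> T"
    and "prob_space.indep_vars M (\<lambda>_. borel)
           (\<lambda>idx :: (nat \<times> nat) + (nat \<times> nat \<times> nat).
              case idx of Inl (k, j) \<Rightarrow> X k j | Inr (n, k, i) \<Rightarrow> W n k i) UNIV"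
    and "\<forall>k j. distributed M lborel (X k j) (normal_density (\<mu> k) 1)"
    and "\<forall>n k i. distributed M lborel (W n k i) (normal_density 0 1)"
  shows "(\<Sum>k=2..K. (\<mu> 1 - \<mu> k) *
            prob_space.expectation M
              (\<lambda>\<omega>. real (pulls (reboot_hist K \<sigma>a (\<lambda>k j. X k j \<omega>) (\<lambda>n k i. W n k i \<omega>) T) k)))
         \<le> (\<Sum>k=2..K. (\<mu> 1 - \<mu> k) *
              (6 + (reboot_C1 \<sigma>a + reboot_C2 \<sigma>a / (\<mu> 1 - \<mu> k)\<^sup>2) * ln (real T)))"
proof -
  interpret prob_space M by fact
  interpret gaussian_reboot M K \<mu> \<sigma>a X W
    using assms by unfold_locales auto
  show ?thesis
  proof (rule sum_mono)
    fix k assume k: "k \<in> {2..K}"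
    then have "k \<in> {1..K}" by auto
    then have "\<mu> k \<le> \<mu> 1" using assms(3) by blast
    then show "(\<mu> 1 - \<mu> k) *
        expectation (\<lambda>\<omega>. real (pulls (reboot_hist K \<sigma>a (\<lambda>k j. X k j \<omega>) (\<lambda>n k i. W n k i \<omega>) T) k))
      \<le> (\<mu> 1 - \<mu> k) * (6 + (reboot_C1 \<sigma>a + reboot_C2 \<sigma>a / (\<mu> 1 - \<mu> k)\<^sup>2) * ln (real T))"
      using expected_pulls_le[OF k _ assms(5)]
      \<comment> \<open>An arm with zero gap contributes 0 on both sides; all others have the
        positive gap that the pull bound requires.\<close>
      by (cases "\<mu> k = \<mu> 1") (auto simp: hist_def intro!: mult_left_mono)
  qed
qed

end
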